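(* Let $\mathbf v\in\mathbb S^{L-1}$ be the SNW steering vector built from a secret key $\mathbf U\in\mathbb R^{L\times M'}$ with $\mathbf U^\top\mathbf U=\mathbf I_{M'}$, a binary codeword $\mathbf c\in\{-1,1\}^{M'}$ and a parameter $\alpha\in[0,1]$. Suppose the extracted normalized vector $\tilde{\mathbf v}$ follows the perturbation model $$\tilde{\mathbf v}=\rho\,\mathbf v+\sqrt{1-\rho^2}\,\mathbf n,\qquad \mathbf n\sim\mathcal U(\mathbb S^{L-2}),\quad \mathbf n\perp\mathbf v .$$ Then the probability $p(\rho)$ of correctly decoding a bit is given by $$p(\rho)=\Phi\!\left(\alpha\,\frac{\rho}{\sqrt{1-\rho^2}}\sqrt{\frac{L}{M'}}\right),$$ where $\Phi$ is the standard Gaussian cumulative distribution function. The resulting Shannon capacity is $$C_\rho=M'\big(1-h_2(p(\rho))\big).$$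
   Context: $L\ge M'\ge 1$ are integers: $L$ is the dimension of the latent (watermarking) space and $M'$ is the codeword length. $\mathbb S^{L-1}$ is the unit sphere of $\mathbb R^L$. $h_2(p)=-p\log_2p-(1-p)\log_2(1-p)$ is the binary entropy function. $\operatorname{sign}(x)=1$ if $x>0$ and $-1$ otherwise. Steering vector: SNW embeds the codeword through the unit vector $$\mathbf v=\alpha\,\frac{\mathbf U\mathbf c}{\sqrt{M'}}+\sqrt{1-\alpha^2}\,\frac{(\mathbf I_L-\mathbf U\mathbf U^\top)\mathbf q}{\|(\mathbf I_L-\mathbf U\mathbf U^\top)\mathbf q\|_2},$$ where $\mathbf q$ is a realization of $\mathcal N(0,\mathbf I_L)$. When $M'=L$, one takes $\alpha=1$ and the second term is absent. Perturbation model: $\rho$ is the cosine alignment between the embedded vector $\mathbf v$ and the vector $\tilde{\mathbf v}$ extracted by the decoding projection from the (possibly transformed) watermarked image. The noise $\mathbf n$ is uniformly distributed on the unit sphere (a copy of $\mathbb S^{L-2}$) of the hyperplane orthogonal to $\mathbf v$. The formula for $p(\rho)$ presupposes $\rho^2<1$. Decoding: the $j$-th bit is decoded as $\operatorname{sign}\big((\mathbf U^\top\tilde{\mathbf v})_j\big)$ and is correctly decoded if this equals $c_j$. The capacity is in bits, for the $M'$ codeword bits treated as independent binary channels, each correct with probability $p(\rho)$.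
   Formalization: The equality p(ρ)=Φ(…) fails at finite L (M'=1, α=1, 0<ρ<1 gives p=1); it is proved as a limit L→∞ for fixed ρ, uniform in M', α, U, c, q and the bit, excluding M'=1, α=1, ρ=0, where it fails; the capacity formula is exact. *)

theory Defs
  imports "HOL-Probability.Probability" "Jordan_Normal_Form.Matrix"
begin

unbundle no vec_syntax
unbundle no inner_syntax

hide_const (open) Permutations.sign

definition sign :: "real \<Rightarrow> real" where
  "sign x = (if x > 0 then 1 else -1)"

definition binary_entropy :: "real \<Rightarrow> real" where
  "binary_entropy p = - p * log 2 p - (1 - p) * log 2 (1 - p)"

definition Phi :: "real \<Rightarrow> real" where
  "Phi x = cdf std_normal_distribution x"

definition vec_norm2 :: "real vec \<Rightarrow> real" where
  "vec_norm2 x = sqrt (x \<bullet> x)"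

definition residual :: "nat \<Rightarrow> real mat \<Rightarrow> real vec \<Rightarrow> real vec" where
  "residual L U q = (1\<^sub>m L - U * U\<^sup>T) *\<^sub>v q"

definition steering_vector ::
    "nat \<Rightarrow> nat \<Rightarrow> real \<Rightarrow> real mat \<Rightarrow> real vec \<Rightarrow> real vec \<Rightarrow> real vec" where
  "steering_vector L M' \<alpha> U c q =
     (if M' = L then (\<alpha> / sqrt (real M')) \<cdot>\<^sub>v (U *\<^sub>v c)
      else (\<alpha> / sqrt (real M')) \<cdot>\<^sub>v (U *\<^sub>v c) +
           (sqrt (1 - \<alpha>\<^sup>2) / vec_norm2 (residual L U q)) \<cdot>\<^sub>v residual L U q)"

text \<open>
  For \<open>q\<close> drawn from the standard Gaussian law the residual is almost surely nonzero when
  \<open>M' < L\<close>, so that is the only property of the realization \<open>q\<close> that is required.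
\<close>

definition snw_parameters ::
    "nat \<Rightarrow> nat \<Rightarrow> real \<Rightarrow> real mat \<Rightarrow> real vec \<Rightarrow> real vec \<Rightarrow> bool" where
  "snw_parameters L M' \<alpha> U c q \<longleftrightarrow>
     1 \<le> M' \<and> M' \<le> L \<and> 0 \<le> \<alpha> \<and> \<alpha> \<le> 1 \<and>
     U \<in> carrier_mat L M' \<and> U\<^sup>T * U = 1\<^sub>m M' \<and>
     c \<in> carrier_vec M' \<and> (\<forall>j<M'. c $ j \<in> {-1, 1}) \<and>
     q \<in> carrier_vec L \<and>
     (if M' = L then \<alpha> = 1 else residual L U q \<noteq> 0\<^sub>v L)"

text \<open>
  Laws of random vectors of length \<open>L\<close> are measures on coordinate functions
  \<open>x \<in> {..<L} \<rightarrow>\<^sub>E \<real>\<close>, read as the vector \<open>vec L x\<close>. The uniform distribution on the unit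
  sphere of the hyperplane orthogonal to \<open>v\<close> is the probability measure on that sphere that is
  invariant under its isometries, i.e. under the orthogonal matrices that fix \<open>v\<close>.
\<close>

definition uniform_on_orthogonal_sphere ::
    "nat \<Rightarrow> real vec \<Rightarrow> (nat \<Rightarrow> real) measure \<Rightarrow> bool" where
  "uniform_on_orthogonal_sphere L v \<mu> \<longleftrightarrow>
     prob_space \<mu> \<and>
     sets \<mu> = sets (Pi\<^sub>M {..<L} (\<lambda>_. borel)) \<and>
     (AE x in \<mu>. vec_norm2 (vec L x) = 1 \<and> vec L x \<bullet> v = 0) \<and>
     (\<forall>Q \<in> carrier_mat L L. Q\<^sup>T * Q = 1\<^sub>m L \<and> Q *\<^sub>v v = v \<longrightarrow>
        distr \<mu> \<mu> (\<lambda>x. \<lambda>i\<in>{..<L}. (Q *\<^sub>v vec L x) $ i) = \<mu>)"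

definition extracted_vector :: "real \<Rightarrow> real vec \<Rightarrow> real vec \<Rightarrow> real vec" where
  "extracted_vector \<rho> v n = \<rho> \<cdot>\<^sub>v v + sqrt (1 - \<rho>\<^sup>2) \<cdot>\<^sub>v n"

definition decoded_bit :: "real mat \<Rightarrow> real vec \<Rightarrow> nat \<Rightarrow> real" where
  "decoded_bit U w j = sign ((U\<^sup>T *\<^sub>v w) $ j)"

definition correct_prob ::
    "nat \<Rightarrow> real \<Rightarrow> real mat \<Rightarrow> real vec \<Rightarrow> real vec \<Rightarrow> (nat \<Rightarrow> real) measure \<Rightarrow> nat \<Rightarrow> real" where
  "correct_prob L \<rho> U c v \<mu> j =
     measure \<mu> {x \<in> space \<mu>. decoded_bit U (extracted_vector \<rho> v (vec L x)) j = c $ j}"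

definition binary_channel :: "real \<Rightarrow> int \<Rightarrow> int pmf" where
  "binary_channel p b = map_pmf (\<lambda>ok. if ok then b else - b) (bernoulli_pmf p)"

definition word_channel :: "nat \<Rightarrow> real \<Rightarrow> int list \<Rightarrow> int list pmf" where
  "word_channel m p xs =
     map_pmf (\<lambda>ys. map ys [0..<m]) (Pi_pmf {..<m} 0 (\<lambda>j. binary_channel p (xs ! j)))"

definition codewords :: "nat \<Rightarrow> int list set" where
  "codewords m = {xs. length xs = m \<and> set xs \<subseteq> {-1, 1}}"

definition channel_information ::
    "('a::countable \<Rightarrow> 'b::countable pmf) \<Rightarrow> 'a pmf \<Rightarrow> real" where
  "channel_information W P =
     prob_space.mutual_information
       (measure_pmf (bind_pmf P (\<lambda>x. map_pmf (Pair x) (W x))))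
       2 (count_space UNIV) (count_space UNIV) fst snd"

definition shannon_capacity ::
    "'a::countable set \<Rightarrow> ('a \<Rightarrow> 'b::countable pmf) \<Rightarrow> real" where
  "shannon_capacity A W = (SUP P \<in> {P. set_pmf P \<subseteq> A}. channel_information W P)"

definition snw_capacity :: "nat \<Rightarrow> real \<Rightarrow> real" where
  "snw_capacity m p = shannon_capacity (codewords m) (word_channel m p)"

text \<open>
  The Gaussian value of the bit probability. For finite \<open>L\<close> the coordinates of a uniform point of
  the sphere are not Gaussian, so it is not the exact value of \<open>correct_prob\<close>: for \<open>M' = 1\<close>,
  \<open>\<alpha> = 1\<close> and \<open>\<rho> > 0\<close> the noise is orthogonal to the only column of \<open>U\<close> and the bit is decoded
  correctly with probability \<open>1\<close>. It is the large-\<open>L\<close> approximation.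
\<close>

definition snw_formula :: "nat \<Rightarrow> nat \<Rightarrow> real \<Rightarrow> real \<Rightarrow> real" where
  "snw_formula L M' \<alpha> \<rho> = Phi (\<alpha> * (\<rho> / sqrt (1 - \<rho>\<^sup>2)) * sqrt (real L / real M'))"

end

theory Submission
  imports Defs "HOL-Real_Asymp.Real_Asymp"
begin

text \<open>
  Let \<open>n\<close> be uniform on the unit sphere of the hyperplane orthogonal to \<open>v\<close>. Bit \<open>j\<close> depends on \<open>n\<close>
  only through its inner product with the column \<open>u\<close> of the key, that is, with the component of
  \<open>u\<close> orthogonal to \<open>v\<close>, whose length is \<open>sqrt (1 - b\<^sup>2)\<close> for \<open>b = \<alpha> / sqrt M'\<close>. Reflections
  show that the law of \<open>n \<bullet> e\<close> is the same for all unit vectors \<open>e\<close> orthogonal to \<open>v\<close>. If \<open>g\<close> is an independent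
  standard Gaussian vector, then \<open>n \<bullet> g\<close> is standard normal given \<open>n\<close>, and given \<open>g\<close> it is
  \<open>n \<bullet> e\<close> scaled by the length of the projection of \<open>g\<close>. That length concentrates
  at \<open>sqrt L\<close>, so \<open>sqrt L * (n \<bullet> e)\<close> is asymptotically standard normal.
  The factor \<open>sqrt (1 - b\<^sup>2)\<close> is harmless: for small \<open>b\<close> it is close to \<open>1\<close>, and for larger \<open>b\<close> and
  \<open>\<rho> \<noteq> 0\<close> both arguments of \<open>Phi\<close> tend to the same infinity.

  For the capacity, the transition matrix on codewords is symmetric with rows of equal
  entropy, so Gibbs' inequality bounds the information by \<open>m * (1 - binary_entropy p)\<close>, and the uniform
  input attains this bound.
\<close>

section \<open>Capacity of symmetric channels\<close>

text \<open>The joint law of input and output has a density with respect to counting measure, so the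
  mutual information is an integral over a countable space. The integrand vanishes outside
  \<open>A \<times> B\<close>, which leaves a finite sum, and the factor \<open>pmf P x\<close>
  cancels inside the logarithm.\<close>

lemma channel_information_eq:
  fixes W :: "'a::countable \<Rightarrow> 'b::countable pmf"
  assumes fin: "finite A" "finite B"
    and P: "set_pmf P \<subseteq> A" and W: "\<And>x. x \<in> A \<Longrightarrow> set_pmf (W x) \<subseteq> B"
  shows "channel_information W P =
    (\<Sum>x\<in>A. \<Sum>y\<in>B. pmf P x * pmf (W x) y * log 2 (pmf (W x) y / pmf (bind_pmf P W) y))"
proof -
  define J where "J = bind_pmf P (\<lambda>x. map_pmf (Pair x) (W x))"
  interpret information_space "measure_pmf J" "2::real"
    by unfold_locales simp
  have cs: "count_space UNIV \<Otimes>\<^sub>M count_space UNIV = (count_space UNIV :: ('a \<times> 'b) measure)"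
    using pair_measure_countable[of "UNIV :: 'a set" "UNIV :: 'b set"] by simp
  have fst_J: "map_pmf fst J = P"
    by (simp add: J_def map_bind_pmf pmf.map_comp comp_def map_pmf_const bind_return_pmf')
  have snd_J: "map_pmf snd J = bind_pmf P W"
    by (simp add: J_def map_bind_pmf pmf.map_comp comp_def)
  have pmf_J: "pmf J (x, y) = pmf P x * pmf (W x) y" for x y
  proof -
    have "pmf (map_pmf (Pair x') (W x')) (x, y) = indicator {x} x' * pmf (W x) y" for x'
      by (auto simp: pmf_map_inj' inj_on_def indicator_def pmf_eq_0_set_pmf)
    then show ?thesis
      by (simp add: J_def pmf_bind measure_pmf_single)
  qed
  have dist: "distributed (measure_pmf J) (count_space UNIV) f (\<lambda>x. ennreal (pmf (map_pmf f J) x))"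
    for f :: "'a \<times> 'b \<Rightarrow> 'c::countable"
    by (simp add: distributed_def map_pmf_rep_eq[symmetric] measure_pmf_eq_density[symmetric])
  have sf: "sigma_finite_measure (count_space (UNIV :: 'c::countable set))"
    by (rule sigma_finite_measure_count_space)
  let ?f = "\<lambda>z. pmf J z * log 2 (pmf J z / (pmf P (fst z) * pmf (bind_pmf P W) (snd z)))"
  have "channel_information W P = prob_space.mutual_information (measure_pmf J) 2 (count_space UNIV) (count_space UNIV) fst snd"
    unfolding channel_information_def J_def by (rule refl)
  also have "\<dots> = integral\<^sup>L (count_space UNIV \<Otimes>\<^sub>M count_space UNIV) ?f"
  proof (rule mutual_information_distr[OF sf sf])
    show "distributed (measure_pmf J) (count_space UNIV) fst (\<lambda>x. ennreal (pmf P x))"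
      using dist[of fst] by (simp add: fst_J)
    show "distributed (measure_pmf J) (count_space UNIV) snd (\<lambda>x. ennreal (pmf (bind_pmf P W) x))"
      using dist[of snd] by (simp add: snd_J)
    show "distributed (measure_pmf J) (count_space UNIV \<Otimes>\<^sub>M count_space UNIV)
        (\<lambda>z. (fst z, snd z)) (\<lambda>z. ennreal (pmf J z))"
      using dist[of "\<lambda>z. z"] by (simp add: cs)
  qed auto
  also have "\<dots> = integral\<^sup>L (count_space UNIV) ?f"
    by (simp add: cs)
  also have "\<dots> = (\<Sum>z | ?f z \<noteq> 0. ?f z)"
  proof -
    have "{z. ?f z \<noteq> 0} \<subseteq> A \<times> B"
      using P W by (force simp: pmf_J set_pmf_iff)
    then have "finite {z. ?f z \<noteq> 0}"
      using fin finite_subset by blast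
    then show ?thesis
      by (subst lebesgue_integral_count_space_finite_support) auto
  qed
  also have "\<dots> = (\<Sum>z\<in>A \<times> B. ?f z)"
    using fin P W by (intro sum.mono_neutral_left) (force simp: pmf_J set_pmf_iff)+
  also have "\<dots> = (\<Sum>x\<in>A. \<Sum>y\<in>B. ?f (x, y))"
    by (simp add: sum.cartesian_product case_prod_unfold)
  also have "\<dots> = (\<Sum>x\<in>A. \<Sum>y\<in>B. pmf P x * pmf (W x) y * log 2 (pmf (W x) y / pmf (bind_pmf P W) y))"
    by (intro sum.cong refl) (auto simp: pmf_J)
  finally show ?thesis .
qed

lemma pmf_bind_finite:
  assumes "finite A" "set_pmf P \<subseteq> A"
  shows "pmf (bind_pmf P W) y = (\<Sum>x\<in>A. pmf P x * pmf (W x) y)"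
  using assms by (simp add: pmf_bind integral_measure_pmf_real[of A] subset_eq mult.commute)

text \<open>This is \<open>ln t \<le> t - 1\<close> at \<open>t = 1 / (card A * pmf Q y)\<close>,
  weighted by \<open>pmf Q y\<close> and summed; the right-hand sides add up to
  \<open>1 - 1\<close>. Points of mass zero are treated apart, since \<open>t\<close> is a division
  by zero there.\<close>

lemma gibbs_inequality_uniform:
  assumes fin: "finite A" and Q: "set_pmf Q \<subseteq> A"
  shows "- (\<Sum>y\<in>A. pmf Q y * log 2 (pmf Q y)) \<le> log 2 (real (card A))"
proof -
  have ne: "A \<noteq> {}" using Q set_pmf_not_empty by fastforce
  then have k: "real (card A) > 0" using fin by (simp add: card_gt_0_iff)
  have one: "(\<Sum>y\<in>A. pmf Q y) = 1" by (rule sum_pmf_eq_1[OF fin Q])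
  have pointwise: "- (pmf Q y * ln (pmf Q y)) - pmf Q y * ln (real (card A)) \<le> 1 / real (card A) - pmf Q y" for y
  proof (cases "pmf Q y = 0")
    case False
    then have q: "pmf Q y > 0" by (simp add: pmf_pos)
    have "pmf Q y * ln (1 / (real (card A) * pmf Q y)) \<le> pmf Q y * (1 / (real (card A) * pmf Q y) - 1)"
      using q k by (intro mult_left_mono ln_le_minus_one) auto
    moreover have "ln (1 / (real (card A) * pmf Q y)) = - ln (real (card A)) - ln (pmf Q y)"
      using q k by (simp add: ln_div ln_mult)
    moreover have "pmf Q y * (1 / (real (card A) * pmf Q y) - 1) = 1 / real (card A) - pmf Q y"
      using q k by (simp add: field_simps)
    ultimately show ?thesis
      by (simp add: algebra_simps)
  qed auto
  have "- (\<Sum>y\<in>A. pmf Q y * ln (pmf Q y)) - (\<Sum>y\<in>A. pmf Q y) * ln (real (card A)) \<le>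
      (\<Sum>y\<in>A. 1 / real (card A)) - (\<Sum>y\<in>A. pmf Q y)"
    unfolding sum_distrib_right sum_negf[symmetric] sum_subtractf[symmetric]
    by (intro sum_mono pointwise)
  then have "- (\<Sum>y\<in>A. pmf Q y * ln (pmf Q y)) \<le> ln (real (card A))"
    using one ne fin by simp
  then have "- (\<Sum>y\<in>A. pmf Q y * ln (pmf Q y)) / ln 2 \<le> ln (real (card A)) / ln 2"
    by (intro divide_right_mono) auto
  then show ?thesis
    by (simp add: log_def sum_divide_distrib)
qed

text \<open>Equal row entropies turn the information into the output entropy minus \<open>h\<close>,
  to which the Gibbs bound applies. Symmetry makes the column sums equal to \<open>1\<close>, so a
  uniform input gives a uniform output and attains the bound.\<close>

lemma shannon_capacity_symmetric:
  fixes W :: "'a::countable \<Rightarrow> 'a pmf"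
  assumes fin: "finite A" and ne: "A \<noteq> {}"
    and W: "\<And>x. x \<in> A \<Longrightarrow> set_pmf (W x) \<subseteq> A"
    and sym: "\<And>x y. x \<in> A \<Longrightarrow> y \<in> A \<Longrightarrow> pmf (W x) y = pmf (W y) x"
    and H: "\<And>x. x \<in> A \<Longrightarrow> (\<Sum>y\<in>A. pmf (W x) y * log 2 (pmf (W x) y)) = - h"
  shows "shannon_capacity A W = log 2 (real (card A)) - h"
proof -
  have info: "channel_information W P =
      - (\<Sum>y\<in>A. pmf (bind_pmf P W) y * log 2 (pmf (bind_pmf P W) y)) - h"
    if P: "set_pmf P \<subseteq> A" for P
  proof -
    let ?Q = "bind_pmf P W"
    have Q: "pmf ?Q y = (\<Sum>x\<in>A. pmf P x * pmf (W x) y)" for y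
      by (rule pmf_bind_finite[OF fin P])
    \<comment> \<open>The logarithm splits only at positive arguments. If the joint mass is zero,
      all terms vanish; if it is positive, it bounds the output mass from below.\<close>
    have split: "pmf P x * pmf (W x) y * log 2 (pmf (W x) y / pmf ?Q y) =
        pmf P x * (pmf (W x) y * log 2 (pmf (W x) y)) - pmf P x * pmf (W x) y * log 2 (pmf ?Q y)"
      if x: "x \<in> A" for x y
    proof (cases "pmf P x * pmf (W x) y = 0")
      case False
      then have pos: "pmf (W x) y > 0" "pmf P x * pmf (W x) y > 0"
        by (auto simp: pmf_pos less_le)
      moreover have "pmf P x * pmf (W x) y \<le> pmf ?Q y"
        unfolding Q using fin x by (intro member_le_sum) auto
      ultimately have "pmf ?Q y > 0" by linarith
      then show ?thesis using pos by (simp add: log_divide algebra_simps)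
    qed auto
    have "channel_information W P =
        (\<Sum>x\<in>A. \<Sum>y\<in>A. pmf P x * (pmf (W x) y * log 2 (pmf (W x) y)) -
          pmf P x * pmf (W x) y * log 2 (pmf ?Q y))"
      using channel_information_eq[OF fin fin P W] split by simp
    also have "\<dots> = (\<Sum>x\<in>A. pmf P x * (\<Sum>y\<in>A. pmf (W x) y * log 2 (pmf (W x) y))) -
        (\<Sum>x\<in>A. \<Sum>y\<in>A. pmf P x * pmf (W x) y * log 2 (pmf ?Q y))"
      by (simp add: sum_subtractf sum_distrib_left)
    also have "(\<Sum>x\<in>A. \<Sum>y\<in>A. pmf P x * pmf (W x) y * log 2 (pmf ?Q y)) =
        (\<Sum>y\<in>A. pmf ?Q y * log 2 (pmf ?Q y))"
      by (subst sum.swap) (simp add: Q sum_distrib_right)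
    also have "(\<Sum>x\<in>A. pmf P x * (\<Sum>y\<in>A. pmf (W x) y * log 2 (pmf (W x) y))) = - h"
      using sum_pmf_eq_1[OF fin P] by (simp add: H sum_negf flip: sum_distrib_right)
    finally show ?thesis by simp
  qed
  have bound: "channel_information W P \<le> log 2 (real (card A)) - h" if P: "set_pmf P \<subseteq> A" for P
  proof -
    have "set_pmf (bind_pmf P W) \<subseteq> A" using P W by auto
    then show ?thesis
      using gibbs_inequality_uniform[OF fin, of "bind_pmf P W"] info[OF P] by simp
  qed
  let ?U = "pmf_of_set A"
  have U: "set_pmf ?U \<subseteq> A" using fin ne by simp
  have "pmf (bind_pmf ?U W) y = 1 / real (card A)" if y: "y \<in> A" for y
  proof -
    have "pmf (bind_pmf ?U W) y = (\<Sum>x\<in>A. 1 / real (card A) * pmf (W x) y)"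
      using fin ne by (simp add: pmf_bind_finite[OF fin U])
    also have "\<dots> = (\<Sum>x\<in>A. pmf (W y) x) / real (card A)"
      using sym[OF _ y] by (simp add: sum_divide_distrib)
    finally show ?thesis using sum_pmf_eq_1[OF fin W[OF y]] by simp
  qed
  then have "channel_information W ?U = log 2 (real (card A)) - h"
    using info[OF U] fin ne by (simp add: log_divide card_gt_0_iff)
  then show ?thesis
    unfolding shannon_capacity_def using bound U by (intro cSup_eq_maximum) (auto intro!: image_eqI)
qed

section \<open>The word channel\<close>

lemma finite_codewords: "finite (codewords m)"
  unfolding codewords_def
  using finite_lists_length_eq[of "{-1, 1 :: int}" m] by (simp add: conj_commute)

lemma codewords_nth: "xs \<in> codewords m \<Longrightarrow> j < m \<Longrightarrow> xs ! j \<in> {-1, 1}"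
  unfolding codewords_def using nth_mem[of j xs] by blast

text \<open>Moves sums over codewords to extensional functions, where a sum of products over all
  choices factors by \<open>prod_sum_PiE\<close>.\<close>

lemma bij_betw_codewords:
  "bij_betw (\<lambda>g. map g [0..<m]) ({..<m} \<rightarrow>\<^sub>E {-1, 1}) (codewords m)"
proof (rule bij_betwI[where g = "\<lambda>ys. \<lambda>j\<in>{..<m}. ys ! j"])
  show "(\<lambda>g. map g [0..<m]) \<in> ({..<m} \<rightarrow>\<^sub>E {-1, 1}) \<rightarrow> codewords m"
    by (auto simp: codewords_def PiE_def Pi_def)
  show "(\<lambda>ys. \<lambda>j\<in>{..<m}. ys ! j) \<in> codewords m \<rightarrow> ({..<m} \<rightarrow>\<^sub>E {-1, 1})"
    by (auto intro!: PiE_I dest: codewords_nth split: if_splits)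
  show "(\<lambda>j\<in>{..<m}. map g [0..<m] ! j) = g" if "g \<in> {..<m} \<rightarrow>\<^sub>E {-1, 1}" for g :: "nat \<Rightarrow> int"
    using that by (auto simp: fun_eq_iff PiE_def extensional_def)
  show "map (\<lambda>j\<in>{..<m}. ys ! j) [0..<m] = ys" if "ys \<in> codewords m" for ys
    using that by (intro nth_equalityI) (auto simp: codewords_def)
qed

lemma card_codewords: "card (codewords m) = 2 ^ m"
  using bij_betw_same_card[OF bij_betw_codewords[of m]] by (simp add: card_PiE numeral_2_eq_2)

lemma sum_codewords_prod:
  fixes f :: "nat \<Rightarrow> int \<Rightarrow> real"
  shows "(\<Sum>ys\<in>codewords m. \<Prod>j<m. f j (ys ! j)) = (\<Prod>j<m. f j (-1) + f j 1)"
proof -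
  have "(\<Sum>ys\<in>codewords m. \<Prod>j<m. f j (ys ! j)) = (\<Sum>g\<in>{..<m} \<rightarrow>\<^sub>E {-1, 1}. \<Prod>j<m. f j (map g [0..<m] ! j))"
    by (rule sum.reindex_bij_betw[OF bij_betw_codewords, symmetric])
  also have "\<dots> = (\<Sum>g\<in>{..<m} \<rightarrow>\<^sub>E {-1, 1}. \<Prod>j<m. f j (g j))"
    by (intro sum.cong prod.cong) auto
  also have "\<dots> = (\<Prod>j<m. \<Sum>b\<in>{-1, 1}. f j b)"
    by (subst prod_sum_PiE) auto
  finally show ?thesis by simp
qed

text \<open>As \<open>b\<close> is nonzero, \<open>b\<close> and \<open>- b\<close> differ, so the
  map from the success flag to the output is injective and each output mass is a single Bernoulli
  mass.\<close>

lemma pmf_binary_channel: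
  assumes p: "p \<in> {0..1}" and b: "b \<in> {-1, 1}" "b' \<in> {-1, 1}"
  shows "pmf (binary_channel p b) b' = (if b' = b then p else 1 - p)"
proof -
  have inj: "inj (\<lambda>ok. if ok then b else - b)" using b by (auto simp: inj_on_def)
  have "b' = (\<lambda>ok. if ok then b else - b) (b' = b)" using b by auto
  then have "pmf (binary_channel p b) b' = pmf (bernoulli_pmf p) (b' = b)"
    unfolding binary_channel_def using pmf_map_inj'[OF inj, of "bernoulli_pmf p" "b' = b"] by presburger
  then show ?thesis using p by auto
qed

lemma set_pmf_word_channel:
  assumes "xs \<in> codewords m"
  shows "set_pmf (word_channel m p xs) \<subseteq> codewords m"
proof
  fix zs assume "zs \<in> set_pmf (word_channel m p xs)"
  then obtain ys where ys: "ys \<in> set_pmf (Pi_pmf {..<m} 0 (\<lambda>j. binary_channel p (xs ! j)))"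
    and zs: "zs = map ys [0..<m]"
    by (auto simp: word_channel_def)
  have "ys j \<in> {-1, 1}" if j: "j < m" for j
  proof -
    have "ys j \<in> set_pmf (binary_channel p (xs ! j))"
      using ys j by (auto simp: set_Pi_pmf PiE_dflt_def)
    moreover have "xs ! j \<in> {-1, 1}"
      using assms j by (rule codewords_nth)
    ultimately show ?thesis by (auto simp: binary_channel_def split: if_splits)
  qed
  then show "zs \<in> codewords m" by (force simp: zs codewords_def)
qed

lemma pmf_word_channel:
  assumes p: "p \<in> {0..1}" and xs: "xs \<in> codewords m" and ys: "ys \<in> codewords m"
  shows "pmf (word_channel m p xs) ys = (\<Prod>j<m. if ys ! j = xs ! j then p else 1 - p)"
proof -
  have len: "length ys = m" using ys by (simp add: codewords_def)
  have mem: "xs ! j \<in> {-1, 1}" "ys ! j \<in> {-1, 1}" if "j < m" for j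
    using xs ys that by (auto dest!: codewords_nth)
  define M where "M = Pi_pmf {..<m} (0::int) (\<lambda>j. binary_channel p (xs ! j))"
  let ?g = "\<lambda>j. if j < m then ys ! j else 0"
  have "pmf (word_channel m p xs) ys = measure M {g. map g [0..<m] = ys}"
    by (simp add: word_channel_def M_def pmf_map vimage_def)
  \<comment> \<open>The event also contains functions that agree with \<open>ys\<close> on
    \<open>{..<m}\<close> and are nonzero somewhere else. They have mass zero, because
    \<open>Pi_pmf\<close> forces the default value \<open>0\<close> outside the index set.\<close>
  also have "\<dots> = measure M {?g}"
  proof (rule measure_prob_cong_0)
    fix g assume g: "g \<in> {g. map g [0..<m] = ys} - {?g}"
    then obtain j where j: "g j \<noteq> ?g j" and ys: "ys = map g [0..<m]" by (auto simp: fun_eq_iff)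
    have "j \<notin> {..<m} \<and> g j \<noteq> 0"
      using j by (cases "j < m") (simp_all add: ys)
    then show "pmf M g = 0" unfolding M_def by (intro pmf_Pi_outside) auto
  next
    fix g assume "g \<in> {?g} - {g. map g [0..<m] = ys}"
    moreover have "map ?g [0..<m] = ys" using len by (intro nth_equalityI) auto
    ultimately show "pmf M g = 0" by auto
  qed
  also have "\<dots> = (\<Prod>j<m. pmf (binary_channel p (xs ! j)) (ys ! j))"
    by (simp add: measure_pmf_single M_def pmf_Pi)
  also have "\<dots> = (\<Prod>j<m. if ys ! j = xs ! j then p else 1 - p)"
    using mem by (intro prod.cong) (auto simp: pmf_binary_channel[OF p])
  finally show ?thesis .
qed

text \<open>Writes the entropy term of a product law as a sum of products, each with one marked
  factor. In this shape \<open>sum_codewords_prod\<close> applies to every summand.\<close>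

lemma prod_mult_log_prod:
  fixes f :: "'i \<Rightarrow> real"
  assumes "finite I" "\<And>i. i \<in> I \<Longrightarrow> 0 \<le> f i"
  shows "(\<Prod>i\<in>I. f i) * log b (\<Prod>i\<in>I. f i) = (\<Sum>k\<in>I. \<Prod>i\<in>I. if i = k then f i * log b (f i) else f i)"
proof -
  have each: "(\<Prod>i\<in>I. if i = k then f i * log b (f i) else f i) = (\<Prod>i\<in>I. f i) * log b (f k)"
    if k: "k \<in> I" for k
  proof -
    have "(\<Prod>i\<in>I. if i = k then f i * log b (f i) else f i) = f k * log b (f k) * (\<Prod>i\<in>I - {k}. f i)"
      using assms(1) k by (subst prod.remove[of I k]) (auto intro!: prod.cong)
    also have "\<dots> = (\<Prod>i\<in>I. f i) * log b (f k)"
      using assms(1) k by (subst prod.remove[of I k]) auto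
    finally show ?thesis .
  qed
  have "(\<Prod>i\<in>I. f i) * log b (\<Prod>i\<in>I. f i) = (\<Prod>i\<in>I. f i) * (\<Sum>k\<in>I. log b (f k))"
  \<comment> \<open>The logarithm is additive for positive factors; if a factor is zero, the product
    in front makes both sides vanish.\<close>
  proof (cases "\<exists>i\<in>I. f i = 0")
    case False
    then have "\<forall>i\<in>I. f i > 0" using assms(2) by (auto simp: less_le)
    then have "ln (\<Prod>i\<in>I. f i) = (\<Sum>k\<in>I. ln (f k))" using assms(1) by (intro ln_prod) auto
    then show ?thesis by (simp add: log_def sum_divide_distrib)
  qed (use assms(1) in auto)
  then show ?thesis by (simp add: each sum_distrib_left)
qed

text \<open>Summed over all words, an unmarked position contributes \<open>p + (1 - p) = 1\<close>
  and the marked one \<open>- binary_entropy p\<close>, whatever the input word \<open>xs\<close>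
  is.\<close>

lemma word_channel_row_entropy:
  assumes p: "p \<in> {0..1}" and xs: "xs \<in> codewords m"
  shows "(\<Sum>ys\<in>codewords m. pmf (word_channel m p xs) ys * log 2 (pmf (word_channel m p xs) ys)) =
    - (real m * binary_entropy p)"
proof -
  let ?f = "\<lambda>j y. if y = xs ! j then p else 1 - p"
  let ?g = "\<lambda>k j y. if j = k then ?f j y * log 2 (?f j y) else ?f j y"
  have mem: "xs ! j \<in> {-1, 1}" if "j < m" for j
    using xs that by (rule codewords_nth)
  have row: "(\<Prod>j<m. ?g k j (-1) + ?g k j 1) = - binary_entropy p" if k: "k < m" for k
  proof -
    have "(\<Prod>j<m. ?g k j (-1) + ?g k j 1) = (\<Prod>j<m. if j = k then - binary_entropy p else 1)"
    proof (rule prod.cong)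
      fix j assume "j \<in> {..<m}"
      then show "?g k j (-1) + ?g k j 1 = (if j = k then - binary_entropy p else 1)"
        using mem[of j] by (auto simp: binary_entropy_def)
    qed simp
    then show ?thesis using k by simp
  qed
  have "(\<Sum>ys\<in>codewords m. pmf (word_channel m p xs) ys * log 2 (pmf (word_channel m p xs) ys)) =
      (\<Sum>ys\<in>codewords m. \<Sum>k<m. \<Prod>j<m. ?g k j (ys ! j))"
    using p by (intro sum.cong refl) (simp add: pmf_word_channel[OF p xs] prod_mult_log_prod cong: if_cong)
  also have "\<dots> = (\<Sum>k<m. \<Prod>j<m. ?g k j (-1) + ?g k j 1)"
    by (subst sum.swap, rule sum.cong[OF refl], rule sum_codewords_prod[of "?g k" for k])
  also have "\<dots> = (\<Sum>k<m. - binary_entropy p)"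
    by (intro sum.cong refl row) simp
  finally show ?thesis by simp
qed

theorem snw_capacity_eq:
  assumes p: "p \<in> {0..1}"
  shows "snw_capacity m p = real m * (1 - binary_entropy p)"
proof -
  have ne: "codewords m \<noteq> {}" using card_codewords[of m] by fastforce
  have "snw_capacity m p = log 2 (real (card (codewords m))) - real m * binary_entropy p"
    unfolding snw_capacity_def
  proof (rule shannon_capacity_symmetric[OF finite_codewords ne set_pmf_word_channel])
    show "pmf (word_channel m p xs) ys = pmf (word_channel m p ys) xs"
      if "xs \<in> codewords m" "ys \<in> codewords m" for xs ys
      using that by (auto simp: pmf_word_channel[OF p] intro!: prod.cong)
  qed (use word_channel_row_entropy[OF p] in auto)
  then show ?thesis
    by (simp add: card_codewords log_nat_power algebra_simps)
qed

text \<open>The delicate points are the endpoints: \<open>0 * log 2 0\<close> evaluates to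
  \<open>0\<close>, which agrees with the limit of \<open>x * log 2 x\<close> at \<open>0\<close>
  from the right. The second summand is the same function reflected.\<close>

lemma continuous_on_binary_entropy: "continuous_on {0..1} binary_entropy"
proof -
  have xlog: "continuous_on {0..1} (\<lambda>x::real. x * log 2 x)"
    unfolding continuous_on_eq_continuous_within
  proof
    fix x :: real assume x: "x \<in> {0..1}"
    show "continuous (at x within {0..1}) (\<lambda>x. x * log 2 x)"
    proof (cases "x = 0")
      case True
      have "((\<lambda>x::real. x * log 2 x) \<longlongrightarrow> 0) (at_right 0)"
        by real_asymp
      then show ?thesis
        by (simp add: continuous_within True at_within_Icc_at_right)
    next
      case False
      then show ?thesis using x by (intro continuous_intros) auto
    qed
  qed
  have "continuous_on {0..1} (\<lambda>x::real. (1 - x) * log 2 (1 - x))"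
    by (rule continuous_on_compose2[OF xlog]) (auto intro!: continuous_intros)
  with xlog have "continuous_on {0..1} (\<lambda>p::real. - (p * log 2 p) - (1 - p) * log 2 (1 - p))"
    by (intro continuous_on_diff continuous_on_minus)
  then show ?thesis
    by (simp add: binary_entropy_def[abs_def])
qed

section \<open>The Gaussian distribution\<close>

interpretation std_normal: real_distribution std_normal_distribution
  by (rule real_dist_normal_dist)

lemma Phi_mono: "x \<le> y \<Longrightarrow> Phi x \<le> Phi y"
  unfolding Phi_def by (rule std_normal.cdf_nondecreasing)

lemma Phi_bounds: "0 \<le> Phi x" "Phi x \<le> 1"
  unfolding Phi_def by (auto intro: std_normal.cdf_nonneg std_normal.cdf_bounded_prob)

text \<open>The increment is the mass of \<open>{x<..y}\<close>, an integral of the density over an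
  interval of length \<open>y - x\<close>.\<close>

lemma Phi_diff_le:
  assumes "x \<le> y" and B: "\<And>z. x \<le> z \<Longrightarrow> z \<le> y \<Longrightarrow> std_normal_density z \<le> B"
  shows "Phi y - Phi x \<le> (y - x) * B"
proof (cases "x = y")
  case False
  with assms have xy: "x < y" by simp
  have B0: "0 \<le> B"
    using B[of x] xy normal_density_nonneg[of 0 1 x] by linarith
  have "ennreal (measure std_normal_distribution {x<..y}) = emeasure std_normal_distribution {x<..y}"
    by (simp add: std_normal.emeasure_eq_measure)
  also have "\<dots> = (\<integral>\<^sup>+z. ennreal (std_normal_density z) * indicator {x<..y} z \<partial>lborel)"
    by (simp add: emeasure_density)
  also have "\<dots> \<le> (\<integral>\<^sup>+z. ennreal B * indicator {x<..y} z \<partial>lborel)"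
    using B by (intro nn_integral_mono) (auto simp: indicator_def intro!: ennreal_leI)
  also have "\<dots> = ennreal ((y - x) * B)"
    using xy B0 by (simp add: nn_integral_cmult ennreal_mult'' mult.commute)
  finally have "measure std_normal_distribution {x<..y} \<le> (y - x) * B"
    using xy B0 by simp
  then show ?thesis
    unfolding Phi_def using std_normal.cdf_diff_eq[OF xy] by simp
qed simp

text \<open>Follows from \<open>x \<le> 1 + x\<^sup>2 / 2 \<le> exp (x\<^sup>2 / 2)\<close>. It
  makes the cost of rescaling the argument of \<open>Phi\<close> independent of that
  argument.\<close>

lemma mult_std_normal_density_le_one: "x * std_normal_density x \<le> 1"
proof -
  have "x \<le> 1 + x\<^sup>2 / 2"
    using zero_le_power2[of "x - 1"] by (simp add: power2_eq_square algebra_simps)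
  also have "\<dots> \<le> exp (x\<^sup>2 / 2)" by (rule exp_ge_add_one_self)
  finally have le: "x * exp (- (x\<^sup>2 / 2)) \<le> 1"
    by (simp add: exp_minus field_simps)
  have "1 \<le> sqrt (2 * pi)"
    using pi_gt3 by simp
  then have "1 / sqrt (2 * pi) \<le> 1" "0 \<le> 1 / sqrt (2 * pi)" by simp_all
  then have "1 / sqrt (2 * pi) * (x * exp (- (x\<^sup>2 / 2))) \<le> 1"
    using le by (meson mult_left_le order_trans)
  then show ?thesis
    by (simp add: std_normal_density_def mult_ac)
qed

lemma std_normal_density_antimono: "0 \<le> x \<Longrightarrow> x \<le> y \<Longrightarrow> std_normal_density y \<le> std_normal_density x"
  by (auto simp: std_normal_density_def intro!: divide_right_mono power_mono)

lemma distr_uminus_std_normal: "distr std_normal_distribution borel uminus = std_normal_distribution"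
proof (rule Levy_uniqueness)
  show "real_distribution (distr std_normal_distribution borel uminus)"
    by (simp add: real_distribution_def real_distribution_axioms_def std_normal.prob_space_distr)
  show "real_distribution std_normal_distribution" by (rule real_dist_normal_dist)
  show "char (distr std_normal_distribution borel uminus) = char std_normal_distribution"
  proof
    fix t
    have "char (distr std_normal_distribution borel uminus) t = char std_normal_distribution (- t)"
      by (simp add: char_def integral_distr)
    then show "char (distr std_normal_distribution borel uminus) t = char std_normal_distribution t"
      by (simp add: char_std_normal_distribution)
  qed
qed

text \<open>The standard normal law is symmetric and has no atoms, so its closed and open upper
  tails have equal mass.\<close>

lemma Phi_minus: "Phi (- x) = 1 - Phi x"
proof -
  have "Phi (- x) = measure (distr std_normal_distribution borel uminus) {..- x}"
    by (simp add: Phi_def cdf_def distr_uminus_std_normal)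
  also have "\<dots> = measure std_normal_distribution {x..}"
    by (subst measure_distr) (auto intro!: arg_cong[where f = "measure _"])
  also have "\<dots> = measure std_normal_distribution {x<..}"
  proof (rule measure_eq_AE)
    have "AE z in lborel. z \<noteq> x" by (rule AE_lborel_singleton)
    then show "AE z in std_normal_distribution. (z \<in> {x..}) = (z \<in> {x<..})"
      by (subst AE_density) auto
  qed auto
  also have "\<dots> = measure std_normal_distribution (space std_normal_distribution - {..x})"
    by (rule arg_cong[where f = "measure _"]) auto
  also have "\<dots> = 1 - Phi x"
    unfolding Phi_def cdf_def by (rule std_normal.prob_compl) simp
  finally show ?thesis .
qed

text \<open>For nonnegative \<open>x\<close> the density decreases from \<open>x\<close> to
  \<open>a * x\<close>, so the increment is at most
  \<open>(a - 1) * (x * std_normal_density x)\<close>. Negative \<open>x\<close> follow by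
  reflection.\<close>

lemma Phi_scale_diff_le:
  assumes "1 \<le> a"
  shows "\<bar>Phi (a * x) - Phi x\<bar> \<le> a - 1"
proof -
  have nonneg: "\<bar>Phi (a * x) - Phi x\<bar> \<le> a - 1" if "0 \<le> x" for x
  proof -
    have ax: "x \<le> a * x" using assms that by (simp add: mult_le_cancel_right1)
    have "Phi (a * x) - Phi x \<le> (a * x - x) * std_normal_density x"
      using ax that by (intro Phi_diff_le std_normal_density_antimono)
    also have "\<dots> = (a - 1) * (x * std_normal_density x)"
      by (simp add: algebra_simps)
    also have "\<dots> \<le> a - 1"
      using assms mult_std_normal_density_le_one[of x] by (simp add: mult_left_le)
    finally show ?thesis using Phi_mono[OF ax] by simp
  qed
  show ?thesis
    using nonneg[of x] nonneg[of "- x"] Phi_minus[of x] Phi_minus[of "a * x"]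
    by (cases "0 \<le> x") auto
qed

lemma Phi_tendsto_1: "(Phi \<longlongrightarrow> 1) at_top"
  unfolding Phi_def[abs_def] by (rule std_normal.cdf_lim_at_top_prob)

section \<open>Standard Gaussian vectors and the concentration of their length\<close>

abbreviation gaussian_vector :: "nat \<Rightarrow> (nat \<Rightarrow> real) measure" where
  "gaussian_vector L \<equiv> Pi\<^sub>M {..<L} (\<lambda>_. std_normal_distribution)"

interpretation std_normal_product: product_prob_space "\<lambda>_::nat. std_normal_distribution" UNIV
  by unfold_locales

lemma prob_space_gaussian_vector: "prob_space (gaussian_vector L)"
  by (intro prob_space_PiM std_normal.prob_space_axioms)

lemma gaussian_vector_component [measurable]:
  "i < L \<Longrightarrow> (\<lambda>g. g i) \<in> borel_measurable (gaussian_vector L)"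
  using measurable_component_singleton[of i "{..<L}" "\<lambda>_. std_normal_distribution"] by simp

lemma gaussian_vector_integral_prod:
  fixes f :: "nat \<Rightarrow> real \<Rightarrow> 'b::{real_normed_field, banach, second_countable_topology}"
  assumes "\<And>i. i < L \<Longrightarrow> integrable std_normal_distribution (f i)"
  shows "(LINT g|gaussian_vector L. (\<Prod>i<L. f i (g i))) = (\<Prod>i<L. LINT x|std_normal_distribution. f i x)"
    and "integrable (gaussian_vector L) (\<lambda>g. \<Prod>i<L. f i (g i))"
  using assms by (auto intro!: std_normal_product.product_integral_prod std_normal_product.product_integrable_prod)

text \<open>By independence the characteristic function factors over the coordinates, and the
  exponents add up to the standard normal one because \<open>a\<close> has unit length.\<close>

lemma gaussian_vector_inner_distr:
  assumes a: "(\<Sum>i<L. (a i)\<^sup>2) = 1"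
  shows "distr (gaussian_vector L) borel (\<lambda>g. \<Sum>i<L. a i * g i) = std_normal_distribution"
proof (rule Levy_uniqueness)
  interpret prob_space "gaussian_vector L" by (rule prob_space_gaussian_vector)
  show "real_distribution (distr (gaussian_vector L) borel (\<lambda>g. \<Sum>i<L. a i * g i))"
    by (intro real_distribution_distr) measurable
  show "real_distribution std_normal_distribution" by (rule real_dist_normal_dist)
  show "char (distr (gaussian_vector L) borel (\<lambda>g. \<Sum>i<L. a i * g i)) = char std_normal_distribution"
  proof
    fix t
    have "char (distr (gaussian_vector L) borel (\<lambda>g. \<Sum>i<L. a i * g i)) t =
        (CLINT g|gaussian_vector L. iexp (t * (\<Sum>i<L. a i * g i)))"
      by (simp add: char_def integral_distr)
    also have "\<dots> = (CLINT g|gaussian_vector L. (\<Prod>i<L. iexp (t * a i * g i)))"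
      by (simp add: sum_distrib_left exp_sum mult.assoc)
    also have "\<dots> = (\<Prod>i<L. CLINT x|std_normal_distribution. iexp (t * a i * x))"
      by (intro gaussian_vector_integral_prod std_normal.integrable_iexp) auto
    also have "\<dots> = (\<Prod>i<L. char std_normal_distribution (t * a i))"
      by (simp add: char_def)
    also have "\<dots> = complex_of_real (\<Prod>i<L. exp (- ((t * a i)\<^sup>2) / 2))"
      by (simp add: char_std_normal_distribution)
    also have "(\<Prod>i<L. exp (- ((t * a i)\<^sup>2) / 2)) = exp (\<Sum>i<L. - ((t * a i)\<^sup>2) / 2)"
      by (simp add: exp_sum)
    also have "(\<Sum>i<L. - ((t * a i)\<^sup>2) / 2) = - (t\<^sup>2 * (\<Sum>i<L. (a i)\<^sup>2)) / 2"
      by (simp add: power_mult_distrib sum_negf sum_divide_distrib sum_distrib_left)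
    also have "complex_of_real (exp \<dots>) = char std_normal_distribution t"
      by (simp add: char_std_normal_distribution a)
    finally show "char (distr (gaussian_vector L) borel (\<lambda>g. \<Sum>i<L. a i * g i)) t = char std_normal_distribution t" .
  qed
qed

lemma std_normal_centered_square_moments:
  shows "integrable std_normal_distribution (\<lambda>x. x\<^sup>2 - 1)"
    and "(LINT x|std_normal_distribution. x\<^sup>2 - 1) = 0"
    and "integrable std_normal_distribution (\<lambda>x. (x\<^sup>2 - 1)\<^sup>2)"
    and "(LINT x|std_normal_distribution. (x\<^sup>2 - 1)\<^sup>2) = 2"
proof -
  have i [simp]: "integrable std_normal_distribution (\<lambda>x. x ^ k)" for k
    by (rule integrable_std_normal_distribution_moment)
  have m2: "(LINT x|std_normal_distribution. x\<^sup>2) = 1"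
    using std_normal_distribution_even_moments(1)[of 1] by simp
  have m4: "(LINT x|std_normal_distribution. x ^ 4) = 3"
    using std_normal_distribution_even_moments(1)[of 2] by (simp add: fact_numeral)
  show "integrable std_normal_distribution (\<lambda>x. x\<^sup>2 - 1)" by simp
  show "(LINT x|std_normal_distribution. x\<^sup>2 - 1) = 0"
    using std_normal.prob_space by (simp add: m2)
  have eq: "(\<lambda>x::real. (x\<^sup>2 - 1)\<^sup>2) = (\<lambda>x. x ^ 4 - 2 * x\<^sup>2 + 1)"
    by (rule ext) (simp add: power2_eq_square power4_eq_xxxx algebra_simps)
  show "integrable std_normal_distribution (\<lambda>x. (x\<^sup>2 - 1)\<^sup>2)"
    unfolding eq by simp
  show "(LINT x|std_normal_distribution. (x\<^sup>2 - 1)\<^sup>2) = 2"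
    unfolding eq using std_normal.prob_space by (simp add: m2 m4)
qed

text \<open>The squared length minus \<open>L\<close> is a sum of independent centred variables of
  variance \<open>2\<close>, so only the diagonal of the expanded double sum survives.\<close>

lemma gaussian_vector_norm_variance:
  shows "integrable (gaussian_vector L) (\<lambda>g. ((\<Sum>i<L. (g i)\<^sup>2) - real L)\<^sup>2)"
    and "(LINT g|gaussian_vector L. ((\<Sum>i<L. (g i)\<^sup>2) - real L)\<^sup>2) = 2 * real L"
proof -
  let ?h = "\<lambda>x::real. x\<^sup>2 - 1"
  \<comment> \<open>\<open>?f i j\<close> spreads a product of two centred squares over all
    coordinates \<open>k\<close>, with factor \<open>1\<close> elsewhere, so that its integral
    factors. For \<open>i = j\<close> both centred squares fall on the same coordinate.\<close>
  let ?f = "\<lambda>i j k x. (if k = i then ?h x else 1) * (if k = j then ?h x else 1)"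
  have int: "integrable std_normal_distribution (?f i j k)" for i j k
    using std_normal_centered_square_moments
    by (cases "k = i"; cases "k = j") (simp_all flip: power2_eq_square)
  have prod: "?h (g i) * ?h (g j) = (\<Prod>k<L. ?f i j k (g k))" if "i < L" "j < L" for i j and g :: "nat \<Rightarrow> real"
    using that by (simp add: prod.distrib)
  have val: "(\<Prod>k<L. LINT x|std_normal_distribution. ?f i j k x) = (if i = j then 2 else 0)"
    if ij: "i < L" "j < L" for i j
  proof (cases "i = j")
    case True
    have "(LINT x|std_normal_distribution. ?f i j k x) = (if k = i then 2 else 1)" for k
      using std_normal_centered_square_moments(4) std_normal.prob_space True
      by (simp flip: power2_eq_square)
    then show ?thesis using True ij by simp
  next
    case False
    then have "(LINT x|std_normal_distribution. ?f i j i x) = 0"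
      using std_normal_centered_square_moments(2) by simp
    then have "(\<Prod>k<L. LINT x|std_normal_distribution. ?f i j k x) = 0"
      using ij by (intro prod_zero bexI[of _ i]) auto
    then show ?thesis using False by simp
  qed
  have expand: "((\<Sum>i<L. (g i)\<^sup>2) - real L)\<^sup>2 = (\<Sum>i<L. \<Sum>j<L. \<Prod>k<L. ?f i j k (g k))" for g :: "nat \<Rightarrow> real"
  proof -
    have "(\<Sum>i<L. (g i)\<^sup>2) - real L = (\<Sum>i<L. ?h (g i))"
      by (simp add: sum_subtractf)
    then have "((\<Sum>i<L. (g i)\<^sup>2) - real L)\<^sup>2 = (\<Sum>i<L. ?h (g i)) * (\<Sum>j<L. ?h (g j))"
      by (simp only: power2_eq_square)
    also have "\<dots> = (\<Sum>i<L. \<Sum>j<L. ?h (g i) * ?h (g j))"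
      by (rule sum_product)
    also have "\<dots> = (\<Sum>i<L. \<Sum>j<L. \<Prod>k<L. ?f i j k (g k))"
      by (intro sum.cong refl prod) auto
    finally show ?thesis .
  qed
  have int': "integrable (gaussian_vector L) (\<lambda>g. \<Prod>k<L. ?f i j k (g k))" for i j
    by (intro gaussian_vector_integral_prod int)
  show "integrable (gaussian_vector L) (\<lambda>g. ((\<Sum>i<L. (g i)\<^sup>2) - real L)\<^sup>2)"
    unfolding expand by (intro Bochner_Integration.integrable_sum int')
  have "(LINT g|gaussian_vector L. ((\<Sum>i<L. (g i)\<^sup>2) - real L)\<^sup>2) =
      (\<Sum>i<L. \<Sum>j<L. LINT g|gaussian_vector L. (\<Prod>k<L. ?f i j k (g k)))"
    unfolding expand
    by (subst Bochner_Integration.integral_sum, intro Bochner_Integration.integrable_sum int')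
      (intro sum.cong refl Bochner_Integration.integral_sum int')
  also have "\<dots> = (\<Sum>i<L. \<Sum>j<L. if i = j then 2 else 0)"
    by (intro sum.cong refl, subst gaussian_vector_integral_prod(1)[OF int], rule val) auto
  finally show "(LINT g|gaussian_vector L. ((\<Sum>i<L. (g i)\<^sup>2) - real L)\<^sup>2) = 2 * real L"
    by simp
qed

text \<open>The quantity compared with \<open>L\<close> is the squared length of the component of
  \<open>g\<close> orthogonal to \<open>v\<close>. A deviation of \<open>\<eta> * L\<close> forces a
  share of at least half from the full squared length or from the squared projection on
  \<open>v\<close>. Chebyshev bounds these events using the variance \<open>2 * L\<close> and the
  second moment \<open>1\<close>.\<close>

lemma gaussian_vector_projection_concentration:
  assumes v: "(\<Sum>i<L. (v i)\<^sup>2) = 1" and \<eta>: "\<eta> > 0" and L: "L > 0"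
  shows "measure (gaussian_vector L) {g \<in> space (gaussian_vector L).
      \<bar>(\<Sum>i<L. (g i)\<^sup>2) - (\<Sum>i<L. v i * g i)\<^sup>2 - real L\<bar> \<ge> \<eta> * real L} \<le>
    8 / (\<eta>\<^sup>2 * real L) + 2 / (\<eta> * real L)"
proof -
  interpret prob_space "gaussian_vector L" by (rule prob_space_gaussian_vector)
  let ?S = "\<lambda>g. (\<Sum>i<L. (g i)\<^sup>2) - real L" and ?T = "\<lambda>g. \<Sum>i<L. v i * g i"
  have S: "prob {g \<in> space (gaussian_vector L). \<bar>?S g\<bar> \<ge> \<eta> * real L / 2} \<le> 8 / (\<eta>\<^sup>2 * real L)"
  proof -
    have "prob {g \<in> space (gaussian_vector L). \<bar>?S g\<bar> \<ge> \<eta> * real L / 2} \<le>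
        expectation (\<lambda>g. (?S g)\<^sup>2) / (\<eta> * real L / 2)\<^sup>2"
      using \<eta> L gaussian_vector_norm_variance(1) by (intro second_moment_method) auto
    also have "\<dots> = 8 / (\<eta>\<^sup>2 * real L)"
      unfolding gaussian_vector_norm_variance using \<eta> L by (simp add: field_simps power2_eq_square)
    finally show ?thesis .
  qed
  have T: "prob {g \<in> space (gaussian_vector L). \<bar>?T g\<bar> \<ge> sqrt (\<eta> * real L / 2)} \<le> 2 / (\<eta> * real L)"
  proof -
    have d: "distr (gaussian_vector L) borel ?T = std_normal_distribution"
      by (rule gaussian_vector_inner_distr[OF v])
    have "integrable (distr (gaussian_vector L) borel ?T) (\<lambda>x. x\<^sup>2)"
      unfolding d by (rule integrable_std_normal_distribution_moment)
    then have int: "integrable (gaussian_vector L) (\<lambda>g. (?T g)\<^sup>2)"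
      by (subst (asm) integrable_distr_eq) auto
    have "(LINT x|distr (gaussian_vector L) borel ?T. x\<^sup>2) = 1"
      unfolding d using std_normal_distribution_even_moments(1)[of 1] by simp
    then have "expectation (\<lambda>g. (?T g)\<^sup>2) = 1"
      by (subst (asm) integral_distr) auto
    moreover have "prob {g \<in> space (gaussian_vector L). \<bar>?T g\<bar> \<ge> sqrt (\<eta> * real L / 2)} \<le>
        expectation (\<lambda>g. (?T g)\<^sup>2) / (sqrt (\<eta> * real L / 2))\<^sup>2"
      using \<eta> L int by (intro second_moment_method) auto
    ultimately show ?thesis using \<eta> L by simp
  qed
  have "prob {g \<in> space (gaussian_vector L). \<bar>(\<Sum>i<L. (g i)\<^sup>2) - (?T g)\<^sup>2 - real L\<bar> \<ge> \<eta> * real L} \<le>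
      prob ({g \<in> space (gaussian_vector L). \<bar>?S g\<bar> \<ge> \<eta> * real L / 2} \<union>
        {g \<in> space (gaussian_vector L). \<bar>?T g\<bar> \<ge> sqrt (\<eta> * real L / 2)})"
  proof (rule finite_measure_mono)
    show "{g \<in> space (gaussian_vector L). \<bar>(\<Sum>i<L. (g i)\<^sup>2) - (?T g)\<^sup>2 - real L\<bar> \<ge> \<eta> * real L} \<subseteq>
      {g \<in> space (gaussian_vector L). \<bar>?S g\<bar> \<ge> \<eta> * real L / 2} \<union>
        {g \<in> space (gaussian_vector L). \<bar>?T g\<bar> \<ge> sqrt (\<eta> * real L / 2)}"
    proof safe
      fix g assume *: "\<bar>(\<Sum>i<L. (g i)\<^sup>2) - (?T g)\<^sup>2 - real L\<bar> \<ge> \<eta> * real L"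
        and n: "\<not> \<bar>?T g\<bar> \<ge> sqrt (\<eta> * real L / 2)"
      then have "(?T g)\<^sup>2 < \<eta> * real L / 2"
        by (metis linorder_not_le real_sqrt_abs real_sqrt_le_iff)
      then show "\<bar>?S g\<bar> \<ge> \<eta> * real L / 2"
        using * zero_le_power2[of "?T g"] by linarith
    qed
  qed measurable
  also have "\<dots> \<le> prob {g \<in> space (gaussian_vector L). \<bar>?S g\<bar> \<ge> \<eta> * real L / 2} +
      prob {g \<in> space (gaussian_vector L). \<bar>?T g\<bar> \<ge> sqrt (\<eta> * real L / 2)}"
    by (rule measure_Un_le) measurable
  finally show ?thesis using S T by linarith
qed

section \<open>Uniform vectors on the sphere orthogonal to a unit vector\<close>

lemma scalar_prod_vec: "w \<in> carrier_vec L \<Longrightarrow> vec L x \<bullet> w = (\<Sum>i<L. x i * w $ i)"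
  by (auto simp: scalar_prod_def lessThan_atLeast0 intro!: sum.cong)

text \<open>The Householder reflection in the hyperplane orthogonal to \<open>u\<close>.\<close>

definition reflection_mat :: "nat \<Rightarrow> real vec \<Rightarrow> real mat" where
  "reflection_mat L u = mat L L (\<lambda>(i, j). (if i = j then 1 else 0) - 2 * u $ i * u $ j / (u \<bullet> u))"

lemma reflection_mat_carrier: "reflection_mat L u \<in> carrier_mat L L"
  by (simp add: reflection_mat_def)

lemma reflection_mat_mult_vec:
  assumes "u \<in> carrier_vec L" "x \<in> carrier_vec L"
  shows "reflection_mat L u *\<^sub>v x = x - (2 * (u \<bullet> x) / (u \<bullet> u)) \<cdot>\<^sub>v u"
proof (rule eq_vecI)
  fix i assume "i < dim_vec (x - (2 * (u \<bullet> x) / (u \<bullet> u)) \<cdot>\<^sub>v u)"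
  then have i: "i < L" using assms by simp
  have "(reflection_mat L u *\<^sub>v x) $ i =
      (\<Sum>j<L. ((if i = j then 1 else 0) - 2 * u $ i * u $ j / (u \<bullet> u)) * x $ j)"
    using i assms by (simp add: reflection_mat_def scalar_prod_def lessThan_atLeast0)
  also have "\<dots> = (\<Sum>j<L. (if i = j then x $ j else 0) - 2 * u $ i / (u \<bullet> u) * (u $ j * x $ j))"
    by (intro sum.cong) (auto simp: algebra_simps)
  also have "\<dots> = x $ i - 2 * u $ i / (u \<bullet> u) * (\<Sum>j<L. u $ j * x $ j)"
    using i by (simp add: sum_subtractf sum_distrib_left)
  also have "(\<Sum>j<L. u $ j * x $ j) = u \<bullet> x"
    using assms by (simp add: scalar_prod_def lessThan_atLeast0)
  finally show "(reflection_mat L u *\<^sub>v x) $ i = (x - (2 * (u \<bullet> x) / (u \<bullet> u)) \<cdot>\<^sub>v u) $ i"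
    using i assms by simp
qed (use assms in \<open>simp add: reflection_mat_def\<close>)

lemma reflection_mat_orthogonal:
  assumes u: "u \<in> carrier_vec L" and nz: "u \<bullet> u \<noteq> 0"
  shows "(reflection_mat L u)\<^sup>T * reflection_mat L u = 1\<^sub>m L"
proof (rule eq_matI)
  fix i j assume "i < dim_row (1\<^sub>m L :: real mat)" "j < dim_col (1\<^sub>m L :: real mat)"
  then have ij: "i < L" "j < L" by simp_all
  define c where "c = 2 / (u \<bullet> u)"
  have s: "(\<Sum>k<L. u $ k * u $ k) = u \<bullet> u"
    using u by (simp add: scalar_prod_def lessThan_atLeast0)
  have "((reflection_mat L u)\<^sup>T * reflection_mat L u) $$ (i, j) =
      (\<Sum>k<L. ((if k = i then 1 else 0) - c * u $ k * u $ i) * ((if k = j then 1 else 0) - c * u $ k * u $ j))"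
    using ij by (simp add: reflection_mat_def scalar_prod_def lessThan_atLeast0 c_def mult_ac)
  also have "\<dots> = (\<Sum>k<L. (if k = i then (if i = j then 1 else 0) - c * u $ k * u $ j else 0) -
      (if k = j then c * u $ k * u $ i else 0) + c * c * u $ i * u $ j * (u $ k * u $ k))"
    by (intro sum.cong) (auto simp: algebra_simps)
  also have "\<dots> = (if i = j then 1 else 0) - c * u $ i * u $ j - c * u $ j * u $ i +
      c * c * u $ i * u $ j * (u \<bullet> u)"
    using ij by (simp add: sum.distrib sum_subtractf flip: sum_distrib_left s)
  also have "\<dots> = (if i = j then 1 else 0)"
    using nz by (simp add: c_def)
  finally show "((reflection_mat L u)\<^sup>T * reflection_mat L u) $$ (i, j) = 1\<^sub>m L $$ (i, j)"
    using ij by simp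
qed (simp_all add: reflection_mat_def)

lemma scalar_prod_self_pos:
  fixes u :: "real vec"
  assumes "u \<noteq> 0\<^sub>v (dim_vec u)"
  shows "u \<bullet> u > 0"
proof -
  from assms obtain i where i: "i < dim_vec u" "u $ i \<noteq> 0"
    by (metis eq_vecI index_zero_vec)
  have "0 < u $ i * u $ i" using i(2) not_real_square_gt_zero by blast
  also have "\<dots> \<le> u \<bullet> u"
    unfolding scalar_prod_def using i(1) by (intro member_le_sum) auto
  finally show ?thesis .
qed

section \<open>One-dimensional projections of the uniform law\<close>

locale uniform_orthogonal_sphere =
  fixes L :: nat and v :: "real vec" and \<mu> :: "(nat \<Rightarrow> real) measure"
  assumes v: "v \<in> carrier_vec L" "v \<bullet> v = 1"
    and uniform: "uniform_on_orthogonal_sphere L v \<mu>"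
begin

sublocale prob_space \<mu>
  using uniform by (simp add: uniform_on_orthogonal_sphere_def)

lemma sets_eq: "sets \<mu> = sets (Pi\<^sub>M {..<L} (\<lambda>_. borel))"
  using uniform by (simp add: uniform_on_orthogonal_sphere_def)

lemma AE_sphere: "AE x in \<mu>. vec L x \<bullet> vec L x = 1 \<and> vec L x \<bullet> v = 0"
  using uniform by (auto simp: uniform_on_orthogonal_sphere_def vec_norm2_def)

lemma borel_measurable_inner [measurable]:
  assumes "w \<in> carrier_vec L"
  shows "(\<lambda>x. vec L x \<bullet> w) \<in> borel_measurable \<mu>"
  unfolding scalar_prod_vec[OF assms] measurable_cong_sets[OF sets_eq refl] by measurable

definition inner_cdf :: "real vec \<Rightarrow> real \<Rightarrow> real" where
  "inner_cdf e y = prob {x \<in> space \<mu>. vec L x \<bullet> e \<le> y}"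

lemma inner_cdf_mono:
  "e \<in> carrier_vec L \<Longrightarrow> y \<le> z \<Longrightarrow> inner_cdf e y \<le> inner_cdf e z"
  unfolding inner_cdf_def by (intro finite_measure_mono) auto

text \<open>The reflection that exchanges \<open>e\<close> and \<open>e'\<close> fixes \<open>v\<close>, so it preserves the measure.\<close>

lemma inner_cdf_independent:
  assumes e: "e \<in> carrier_vec L" "e \<bullet> e = 1" "e \<bullet> v = 0"
    and e': "e' \<in> carrier_vec L" "e' \<bullet> e' = 1" "e' \<bullet> v = 0"
  shows "inner_cdf e y = inner_cdf e' y"
proof (cases "e = e'")
  case False
  define u where "u = e - e'"
  have u: "u \<in> carrier_vec L" using e e' by (simp add: u_def)
  have "u \<noteq> 0\<^sub>v L"
  proof
    assume *: "u = 0\<^sub>v L"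
    have "e = e'"
    proof (rule eq_vecI)
      fix i assume "i < dim_vec e'"
      then have "(e - e') $ i = 0" using * e' by (simp add: u_def)
      then show "e $ i = e' $ i" using \<open>i < dim_vec e'\<close> by simp
    qed (use e e' in auto)
    with False show False ..
  qed
  then have nz: "u \<bullet> u > 0" using u scalar_prod_self_pos[of u] by simp
  have sym: "e' \<bullet> e = e \<bullet> e'" using e e' by (intro comm_scalar_prod)
  have uu: "u \<bullet> u = 2 - 2 * (e \<bullet> e')"
    using e e' u by (simp add: u_def scalar_prod_minus_distrib minus_scalar_prod_distrib[of _ L] sym)
  have ue': "u \<bullet> e' = (e \<bullet> e') - 1"
    using e e' by (simp add: u_def minus_scalar_prod_distrib[of _ L])
  have uv: "u \<bullet> v = 0"
    using e e' v by (simp add: u_def minus_scalar_prod_distrib[of _ L])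
  let ?Q = "reflection_mat L u"
  let ?T = "\<lambda>x. \<lambda>i\<in>{..<L}. (?Q *\<^sub>v vec L x) $ i"
  have Qv: "?Q *\<^sub>v v = v"
    using u v by (auto simp: reflection_mat_mult_vec uv)
  have inv: "distr \<mu> \<mu> ?T = \<mu>"
    using uniform reflection_mat_carrier[of L u] reflection_mat_orthogonal[OF u] nz Qv
    unfolding uniform_on_orthogonal_sphere_def by auto
  have Q_adj: "vec L (?T x) \<bullet> e = vec L x \<bullet> e'" for x
  proof -
    let ?x = "vec L x"
    have x: "?x \<in> carrier_vec L" by simp
    have "vec L (?T x) = ?Q *\<^sub>v ?x"
      using reflection_mat_carrier[of L u] by (intro eq_vecI) auto
    then have "vec L (?T x) \<bullet> e = ?x \<bullet> e - 2 * (u \<bullet> ?x) / (u \<bullet> u) * (u \<bullet> e)"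
      using e u x by (simp add: reflection_mat_mult_vec minus_scalar_prod_distrib[of _ L] smult_scalar_prod_distrib[of _ L])
    also have "u \<bullet> e = 1 - e \<bullet> e'"
      using e e' by (simp add: u_def minus_scalar_prod_distrib[of _ L] sym)
    \<comment> \<open>By \<open>uu\<close>, \<open>u \<bullet> u\<close> is twice
      \<open>1 - e \<bullet> e'\<close>, so the reflection coefficient collapses.\<close>
    also have "2 * (u \<bullet> ?x) / (u \<bullet> u) * (1 - e \<bullet> e') = u \<bullet> ?x"
      using nz unfolding uu by (simp add: field_simps)
    also have "u \<bullet> ?x = ?x \<bullet> e - ?x \<bullet> e'"
      using e e' x by (simp add: u_def minus_scalar_prod_distrib[of _ L] comm_scalar_prod[of _ L])
    also have "?x \<bullet> e - (?x \<bullet> e - ?x \<bullet> e') = ?x \<bullet> e'" by simp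
    finally show ?thesis .
  qed
  have T: "?T \<in> measurable \<mu> \<mu>"
    unfolding measurable_cong_sets[OF sets_eq sets_eq]
  proof (rule measurable_restrict)
    fix i assume "i \<in> {..<L}"
    then have "(\<lambda>x. (?Q *\<^sub>v vec L x) $ i) = (\<lambda>x. \<Sum>j<L. ?Q $$ (i, j) * x j)"
      using reflection_mat_carrier[of L u]
      by (auto simp: scalar_prod_def lessThan_atLeast0 intro!: ext sum.cong)
    then show "(\<lambda>x. (?Q *\<^sub>v vec L x) $ i) \<in> borel_measurable (Pi\<^sub>M {..<L} (\<lambda>_. borel))"
      by simp
  qed
  have "inner_cdf e y = measure (distr \<mu> \<mu> ?T) {x \<in> space \<mu>. vec L x \<bullet> e \<le> y}"
    by (simp add: inner_cdf_def inv)
  also have "\<dots> = prob (?T -` {x \<in> space \<mu>. vec L x \<bullet> e \<le> y} \<inter> space \<mu>)"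
    using e by (intro measure_distr T) measurable
  also have "?T -` {x \<in> space \<mu>. vec L x \<bullet> e \<le> y} \<inter> space \<mu> = {x \<in> space \<mu>. vec L x \<bullet> e' \<le> y}"
    using measurable_space[OF T] by (auto simp: Q_adj)
  finally show ?thesis by (simp add: inner_cdf_def)
qed simp

lemma borel_measurable_component [measurable]: "i < L \<Longrightarrow> (\<lambda>x. x i) \<in> borel_measurable \<mu>"
  unfolding measurable_cong_sets[OF sets_eq refl] by measurable

text \<open>Both sides are the probability that the inner product of the spherical vector with an
  independent Gaussian vector is at most \<open>t\<close>.\<close>

lemma Phi_eq_mixture:
  "ennreal (Phi t) =
    (\<integral>\<^sup>+g. ennreal (prob {x \<in> space \<mu>. vec L x \<bullet> vec L g \<le> t}) \<partial>gaussian_vector L)"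
proof -
  interpret \<gamma>: prob_space "gaussian_vector L" by (rule prob_space_gaussian_vector)
  interpret pair_sigma_finite \<mu> "gaussian_vector L" ..
  let ?X = "{z \<in> space (\<mu> \<Otimes>\<^sub>M gaussian_vector L). (\<Sum>i<L. fst z i * snd z i) \<le> t}"
  have ip: "vec L x \<bullet> vec L g = (\<Sum>i<L. x i * g i)" for x g
    by (simp add: scalar_prod_def lessThan_atLeast0)
  have X: "?X \<in> sets (\<mu> \<Otimes>\<^sub>M gaussian_vector L)" by measurable
  have "emeasure (\<mu> \<Otimes>\<^sub>M gaussian_vector L) ?X = (\<integral>\<^sup>+x. emeasure (gaussian_vector L) (Pair x -` ?X) \<partial>\<mu>)"
    by (rule \<gamma>.emeasure_pair_measure_alt[OF X])
  also have "\<dots> = (\<integral>\<^sup>+x. ennreal (Phi t) \<partial>\<mu>)"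
  proof (rule nn_integral_cong_AE)
    \<comment> \<open>Almost every fixed \<open>x\<close> is a unit vector, so its inner product
      with the Gaussian vector is standard normal.\<close>
    show "AE x in \<mu>. emeasure (gaussian_vector L) (Pair x -` ?X) = ennreal (Phi t)"
      using AE_sphere AE_space
    proof eventually_elim
      case (elim x)
      then have unit: "(\<Sum>i<L. (x i)\<^sup>2) = 1" by (simp add: ip power2_eq_square)
      have "Pair x -` ?X = (\<lambda>g. \<Sum>i<L. x i * g i) -` {..t} \<inter> space (gaussian_vector L)"
        using elim by (auto simp: space_pair_measure)
      then have "emeasure (gaussian_vector L) (Pair x -` ?X) =
          emeasure (distr (gaussian_vector L) borel (\<lambda>g. \<Sum>i<L. x i * g i)) {..t}"
        by (simp add: emeasure_distr)
      then show ?case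
        by (simp add: gaussian_vector_inner_distr[OF unit] Phi_def cdf_def std_normal.emeasure_eq_measure)
    qed
  qed
  also have "\<dots> = ennreal (Phi t)"
    by (simp add: emeasure_space_1)
  finally have "ennreal (Phi t) = emeasure (\<mu> \<Otimes>\<^sub>M gaussian_vector L) ?X" by simp
  also have "\<dots> = (\<integral>\<^sup>+g. emeasure \<mu> ((\<lambda>x. (x, g)) -` ?X) \<partial>gaussian_vector L)"
    by (rule emeasure_pair_measure_alt2[OF X])
  also have "\<dots> = (\<integral>\<^sup>+g. ennreal (prob {x \<in> space \<mu>. vec L x \<bullet> vec L g \<le> t}) \<partial>gaussian_vector L)"
  proof (rule nn_integral_cong)
    fix g assume "g \<in> space (gaussian_vector L)"
    then have "(\<lambda>x. (x, g)) -` ?X = {x \<in> space \<mu>. vec L x \<bullet> vec L g \<le> t}"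
      by (auto simp: space_pair_measure ip)
    then show "emeasure \<mu> ((\<lambda>x. (x, g)) -` ?X) = ennreal (prob {x \<in> space \<mu>. vec L x \<bullet> vec L g \<le> t})"
      by (simp add: emeasure_eq_measure)
  qed
  finally show ?thesis .
qed

text \<open>On the support only the component of \<open>w\<close> orthogonal to \<open>v\<close> matters.\<close>

lemma prob_inner_le_eq_inner_cdf:
  assumes e: "e \<in> carrier_vec L" "e \<bullet> e = 1" "e \<bullet> v = 0"
    and w: "w \<in> carrier_vec L" and r: "w \<bullet> w - (w \<bullet> v)\<^sup>2 = r\<^sup>2" "r > 0"
  shows "prob {x \<in> space \<mu>. vec L x \<bullet> w \<le> t} = inner_cdf e (t / r)"
proof -
  define u where "u = w - (w \<bullet> v) \<cdot>\<^sub>v v"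
  have u: "u \<in> carrier_vec L" using w v by (simp add: u_def)
  have vw: "v \<bullet> w = w \<bullet> v" using v w by (intro comm_scalar_prod)
  have uv: "u \<bullet> v = 0"
    using w v by (simp add: u_def minus_scalar_prod_distrib[of _ L])
  have uu: "u \<bullet> u = r\<^sup>2"
    using w v r(1) u uv
    by (simp add: u_def minus_scalar_prod_distrib[of _ L] scalar_prod_minus_distrib[of _ L] vw power2_eq_square)
  define e' where "e' = (1 / r) \<cdot>\<^sub>v u"
  have e': "e' \<in> carrier_vec L" "e' \<bullet> e' = 1" "e' \<bullet> v = 0"
    using u uv uu v r(2) by (simp_all add: e'_def power2_eq_square)
  have "prob {x \<in> space \<mu>. vec L x \<bullet> w \<le> t} = prob {x \<in> space \<mu>. vec L x \<bullet> e' \<le> t / r}"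
  proof (rule measure_eq_AE)
    show "AE x in \<mu>. (x \<in> {x \<in> space \<mu>. vec L x \<bullet> w \<le> t}) = (x \<in> {x \<in> space \<mu>. vec L x \<bullet> e' \<le> t / r})"
      using AE_sphere
    proof eventually_elim
      case (elim x)
      have "vec L x \<bullet> u = vec L x \<bullet> w"
        using elim w v by (simp add: u_def scalar_prod_minus_distrib[of _ L])
      then have "vec L x \<bullet> e' = (vec L x \<bullet> w) / r"
        using u by (simp add: e'_def)
      then show ?case using r(2) by (simp add: divide_le_cancel)
    qed
  qed (use w e' in measurable)
  also have "\<dots> = inner_cdf e (t / r)"
    using inner_cdf_independent[OF e' e] by (simp add: inner_cdf_def)
  finally show ?thesis .
qed

text \<open>In the mixture, each \<open>g\<close> contributes \<open>inner_cdf e (t / r)\<close>,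
  where \<open>r\<close> is the length of its component orthogonal to \<open>v\<close>. Off
  \<open>Bad\<close> this radius lies in the window of \<open>bounds\<close>; on \<open>Bad\<close>,
  of mass at most \<open>\<delta>\<close>, the trivial bounds \<open>0\<close> and \<open>1\<close>
  are used.\<close>

lemma Phi_between_inner_cdf:
  assumes e: "e \<in> carrier_vec L" "e \<bullet> e = 1" "e \<bullet> v = 0"
    and \<eta>: "0 < \<eta>" "\<eta> < 1" and L: "L > 0"
    and bounds: "\<And>r. sqrt (1 - \<eta>) * sqrt (real L) \<le> r \<Longrightarrow> r \<le> sqrt (1 + \<eta>) * sqrt (real L) \<Longrightarrow>
      lo \<le> inner_cdf e (t / r) \<and> inner_cdf e (t / r) \<le> hi"
    and lo: "0 \<le> lo" "lo \<le> 1" and hi: "0 \<le> hi"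
  defines "\<delta> \<equiv> 8 / (\<eta>\<^sup>2 * real L) + 2 / (\<eta> * real L)"
  shows "lo - \<delta> \<le> Phi t" and "Phi t \<le> hi + \<delta>"
proof -
  interpret \<gamma>: prob_space "gaussian_vector L" by (rule prob_space_gaussian_vector)
  let ?R = "\<lambda>g. (\<Sum>i<L. (g i)\<^sup>2) - (\<Sum>i<L. v $ i * g i)\<^sup>2"
  let ?H = "\<lambda>g. prob {x \<in> space \<mu>. vec L x \<bullet> vec L g \<le> t}"
  define Bad where "Bad = {g \<in> space (gaussian_vector L). \<bar>?R g - real L\<bar> \<ge> \<eta> * real L}"
  have Bad_sets [measurable]: "Bad \<in> sets (gaussian_vector L)"
    unfolding Bad_def by measurable
  have "(\<Sum>i<L. (v $ i)\<^sup>2) = 1"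
    using v by (simp add: scalar_prod_def lessThan_atLeast0 power2_eq_square)
  from gaussian_vector_projection_concentration[OF this \<eta>(1) L]
  have Bad_le: "\<gamma>.prob Bad \<le> \<delta>" by (simp add: Bad_def \<delta>_def)
  have good: "lo \<le> ?H g \<and> ?H g \<le> hi" if g: "g \<in> space (gaussian_vector L) - Bad" for g
  proof -
    have "\<bar>?R g - real L\<bar> < \<eta> * real L" using g by (auto simp: Bad_def)
    then have R: "(1 - \<eta>) * real L \<le> ?R g" "?R g \<le> (1 + \<eta>) * real L"
      by (auto simp: algebra_simps abs_less_iff)
    moreover have "0 < (1 - \<eta>) * real L" using \<eta> L by simp
    ultimately have pos: "0 < ?R g" by linarith
    have eq: "vec L g \<bullet> vec L g - (vec L g \<bullet> v)\<^sup>2 = (sqrt (?R g))\<^sup>2"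
      using pos v by (simp add: scalar_prod_vec power2_eq_square mult.commute)
    have "?H g = inner_cdf e (t / sqrt (?R g))"
      using pos by (intro prob_inner_le_eq_inner_cdf[OF e _ eq]) auto
    moreover have "sqrt (1 - \<eta>) * sqrt (real L) \<le> sqrt (?R g)" "sqrt (?R g) \<le> sqrt (1 + \<eta>) * sqrt (real L)"
      using R by (simp_all flip: real_sqrt_mult)
    ultimately show ?thesis using bounds by simp
  qed
  have "ennreal (Phi t) \<le> (\<integral>\<^sup>+g. ennreal hi + indicator Bad g \<partial>gaussian_vector L)"
    unfolding Phi_eq_mixture
  proof (rule nn_integral_mono)
    fix g assume g: "g \<in> space (gaussian_vector L)"
    show "ennreal (?H g) \<le> ennreal hi + indicator Bad g"
    proof (cases "g \<in> Bad")
      case True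
      have "ennreal (?H g) \<le> ennreal 1" by (intro ennreal_leI) simp
      also have "\<dots> \<le> ennreal hi + indicator Bad g" using True by (simp add: add_increasing)
      finally show ?thesis .
    next
      case False
      then show ?thesis using good[of g] g by (simp add: ennreal_leI)
    qed
  qed
  also have "\<dots> = ennreal (hi + \<gamma>.prob Bad)"
    using hi by (simp add: nn_integral_add \<gamma>.prob_space \<gamma>.emeasure_eq_measure)
  finally have "Phi t \<le> hi + \<gamma>.prob Bad"
    using hi by (subst (asm) ennreal_le_iff) auto
  then show "Phi t \<le> hi + \<delta>" using Bad_le by linarith
  \<comment> \<open>Discarding \<open>Bad\<close> costs the factor
    \<open>1 - \<gamma>.prob Bad\<close>; since \<open>lo \<le> 1\<close>, the loss is at most
    \<open>\<gamma>.prob Bad\<close>.\<close>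
  have "ennreal (lo * (1 - \<gamma>.prob Bad)) = (\<integral>\<^sup>+g. ennreal lo * indicator (space (gaussian_vector L) - Bad) g \<partial>gaussian_vector L)"
    using lo by (simp add: nn_integral_cmult_indicator \<gamma>.emeasure_eq_measure \<gamma>.prob_compl ennreal_mult'')
  also have "\<dots> \<le> ennreal (Phi t)"
    unfolding Phi_eq_mixture using good
    by (intro nn_integral_mono) (auto simp: indicator_def intro!: ennreal_leI)
  finally have "lo * (1 - \<gamma>.prob Bad) \<le> Phi t"
    using Phi_bounds by simp
  moreover have "lo * \<gamma>.prob Bad \<le> \<gamma>.prob Bad"
    using lo by (intro mult_left_le_one_le) auto
  ultimately show "lo - \<delta> \<le> Phi t" using Bad_le by (simp add: algebra_simps)
qed

text \<open>The preceding sandwich is applied at levels \<open>t\<close> rescaled so that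
  \<open>t / r\<close> stays on one side of \<open>y\<close> for every radius in the window.
  \<open>Phi_scale_diff_le\<close> then undoes the rescaling.\<close>

theorem inner_cdf_approx_Phi:
  assumes e: "e \<in> carrier_vec L" "e \<bullet> e = 1" "e \<bullet> v = 0"
    and \<eta>: "0 < \<eta>" "\<eta> < 1" and L: "L > 0"
  shows "\<bar>inner_cdf e y - Phi (y * sqrt (real L))\<bar> \<le>
    8 / (\<eta>\<^sup>2 * real L) + 2 / (\<eta> * real L) + (1 / sqrt (1 - \<eta>) - 1)"
proof -
  let ?\<delta> = "8 / (\<eta>\<^sup>2 * real L) + 2 / (\<eta> * real L)"
  let ?a = "sqrt (1 - \<eta>)" and ?b = "sqrt (1 + \<eta>)" and ?s = "sqrt (real L)"
  have pos: "0 < ?a" "0 < ?s" "0 < ?b" using \<eta> L by auto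
  have a1: "?a \<le> 1" and b1: "1 \<le> ?b" using \<eta> by auto
  \<comment> \<open>Lets the single error term \<open>1 / ?a - 1\<close> cover both the enlarging
    and the shrinking factor.\<close>
  have ab: "?b \<le> 1 / ?a"
  proof -
    have "?b * ?a = sqrt (1 - \<eta>\<^sup>2)"
      by (simp add: power2_eq_square algebra_simps flip: real_sqrt_mult)
    also have "\<dots> \<le> 1" by simp
    finally show ?thesis using pos by (simp add: field_simps)
  qed
  have 01: "0 \<le> inner_cdf e z" "inner_cdf e z \<le> 1" for z by (simp_all add: inner_cdf_def)
  have A: "\<bar>Phi (y * ?a * ?s) - Phi (y * ?s)\<bar> \<le> 1 / ?a - 1"
    using Phi_scale_diff_le[of "1 / ?a" "y * ?a * ?s"] pos a1 by (simp add: abs_minus_commute)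
  have B: "\<bar>Phi (y * ?b * ?s) - Phi (y * ?s)\<bar> \<le> 1 / ?a - 1"
    using Phi_scale_diff_le[of ?b "y * ?s"] b1 ab by (simp add: mult_ac)
  \<comment> \<open>Enlarging \<open>y\<close> in absolute value raises it when nonnegative and
    lowers it when negative. With the sign taken into account, \<open>c\<close> keeps
    \<open>t / r\<close> above \<open>y\<close> and \<open>d\<close> keeps it below.\<close>
  define c where "c = (if 0 \<le> y then ?b else ?a)"
  define d where "d = (if 0 \<le> y then ?a else ?b)"
  have cd: "y \<le> y * c * ?s / r" "y * d * ?s / r \<le> y" if r: "?a * ?s \<le> r" "r \<le> ?b * ?s" for r
  proof -
    have "0 < r" using r pos by (meson less_le_trans mult_pos_pos)
    then show "y \<le> y * c * ?s / r" "y * d * ?s / r \<le> y"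
      using r by (auto simp: c_def d_def pos_le_divide_eq pos_divide_le_eq mult.assoc
          intro: mult_left_mono mult_left_mono_neg)
  qed
  have "inner_cdf e y - ?\<delta> \<le> Phi (y * c * ?s)"
    by (rule Phi_between_inner_cdf(1)[OF e \<eta> L, where hi = 1]) (use e(1) 01 cd(1) inner_cdf_mono in auto)
  moreover have "Phi (y * d * ?s) \<le> inner_cdf e y + ?\<delta>"
    by (rule Phi_between_inner_cdf(2)[OF e \<eta> L, where lo = 0]) (use e(1) 01 cd(2) inner_cdf_mono in auto)
  moreover have "\<bar>Phi (y * c * ?s) - Phi (y * ?s)\<bar> \<le> 1 / ?a - 1"
      "\<bar>Phi (y * d * ?s) - Phi (y * ?s)\<bar> \<le> 1 / ?a - 1"
    using A B by (auto simp: c_def d_def)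
  ultimately show ?thesis by linarith
qed

end

section \<open>Decoding the SNW codeword\<close>

lemma residual_eq:
  assumes "U \<in> carrier_mat L m" "q \<in> carrier_vec L"
  shows "residual L U q = q - U *\<^sub>v (U\<^sup>T *\<^sub>v q)"
proof -
  have "residual L U q = 1\<^sub>m L *\<^sub>v q - (U * U\<^sup>T) *\<^sub>v q"
    unfolding residual_def using assms by (intro minus_mult_distrib_mat_vec[of _ L L]) auto
  also have "(U * U\<^sup>T) *\<^sub>v q = U *\<^sub>v (U\<^sup>T *\<^sub>v q)"
    using assms by (intro assoc_mult_mat_vec) auto
  finally show ?thesis using assms by simp
qed

context
  fixes L M' :: nat and \<alpha> :: real and U :: "real mat" and c q v :: "real vec"
  assumes snw: "snw_parameters L M' \<alpha> U c q"
  defines "v \<equiv> steering_vector L M' \<alpha> U c q"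
begin

lemma snw_carriers:
  "U \<in> carrier_mat L M'" "c \<in> carrier_vec M'" "q \<in> carrier_vec L" "residual L U q \<in> carrier_vec L"
proof -
  show U: "U \<in> carrier_mat L M'" and "c \<in> carrier_vec M'" and q: "q \<in> carrier_vec L"
    using snw by (auto simp: snw_parameters_def)
  then show "residual L U q \<in> carrier_vec L" by (simp add: residual_eq)
qed

lemma key_orthonormal: "U\<^sup>T * U = 1\<^sub>m M'"
  using snw by (simp add: snw_parameters_def)

lemma steering_vector_carrier: "v \<in> carrier_vec L"
  using snw_carriers by (auto simp: v_def steering_vector_def)

lemma transpose_mult_codeword: "U\<^sup>T *\<^sub>v (U *\<^sub>v c) = c"
proof -
  have "U\<^sup>T *\<^sub>v (U *\<^sub>v c) = (U\<^sup>T * U) *\<^sub>v c"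
    using snw_carriers by (intro assoc_mult_mat_vec[symmetric]) auto
  also have "\<dots> = c" using snw_carriers by (simp only: key_orthonormal one_mult_mat_vec)
  finally show ?thesis .
qed

text \<open>\<open>U * U\<^sup>T\<close> is the orthogonal projection onto the column space of
  \<open>U\<close>, so the residual is orthogonal to every column.\<close>

lemma transpose_mult_residual: "U\<^sup>T *\<^sub>v residual L U q = 0\<^sub>v M'"
proof -
  have q: "U\<^sup>T *\<^sub>v q \<in> carrier_vec M'" using snw_carriers by auto
  have "U\<^sup>T *\<^sub>v residual L U q = U\<^sup>T *\<^sub>v q - U\<^sup>T *\<^sub>v (U *\<^sub>v (U\<^sup>T *\<^sub>v q))"
    unfolding residual_eq[OF snw_carriers(1,3)]
    using snw_carriers q by (intro mult_minus_distrib_mat_vec) auto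
  also have "U\<^sup>T *\<^sub>v (U *\<^sub>v (U\<^sup>T *\<^sub>v q)) = (U\<^sup>T * U) *\<^sub>v (U\<^sup>T *\<^sub>v q)"
    using snw_carriers q by (intro assoc_mult_mat_vec[symmetric]) auto
  also have "\<dots> = U\<^sup>T *\<^sub>v q"
    using q by (simp only: key_orthonormal one_mult_mat_vec)
  finally show ?thesis using q by simp
qed

lemma transpose_mult_steering_vector: "U\<^sup>T *\<^sub>v v = (\<alpha> / sqrt (real M')) \<cdot>\<^sub>v c"
proof -
  note [simp] = transpose_mult_codeword transpose_mult_residual
  have UT: "U\<^sup>T \<in> carrier_mat M' L" and Uc: "U *\<^sub>v c \<in> carrier_vec L" using snw_carriers by auto
  show ?thesis
    using snw_carriers Uc UT
    by (auto simp: v_def steering_vector_def mult_mat_vec[of _ M' L] mult_add_distrib_mat_vec[of _ M' L])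
qed

lemma codeword_norm: "c \<bullet> c = real M'"
proof -
  have "c \<bullet> c = (\<Sum>j<M'. c $ j * c $ j)"
    using snw_carriers by (simp add: scalar_prod_def lessThan_atLeast0)
  also have "\<dots> = (\<Sum>j<M'. 1)"
    using snw by (intro sum.cong) (auto simp: snw_parameters_def)
  finally show ?thesis by simp
qed

text \<open>The codeword part and the residual part are orthogonal, with squared lengths
  \<open>\<alpha>\<^sup>2\<close> and \<open>1 - \<alpha>\<^sup>2\<close>. When
  \<open>M' = L\<close>, only the first is present and \<open>\<alpha> = 1\<close>.\<close>

lemma steering_vector_unit: "v \<bullet> v = 1"
proof -
  let ?a = "U *\<^sub>v c" and ?r = "residual L U q"
  have a: "?a \<in> carrier_vec L" and r: "?r \<in> carrier_vec L" using snw_carriers by auto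
  have adj: "x \<bullet> ?a = (U\<^sup>T *\<^sub>v x) \<bullet> c" if "x \<in> carrier_vec L" for x
    using transpose_vec_mult_scalar[of U L M' c x] snw_carriers that by simp
  have aa: "?a \<bullet> ?a = real M'"
    using adj[OF a] by (simp add: transpose_mult_codeword codeword_norm)
  have ra: "?r \<bullet> ?a = 0"
    using adj[OF r] snw_carriers by (simp add: transpose_mult_residual)
  have ar: "?a \<bullet> ?r = 0" using ra comm_scalar_prod[OF a r] by simp
  have M: "real M' > 0" using snw by (simp add: snw_parameters_def)
  show ?thesis
  proof (cases "M' = L")
    case True
    then show ?thesis using snw a aa M
      by (simp add: v_def steering_vector_def snw_parameters_def)
  next
    case False
    have rr: "?r \<bullet> ?r > 0"
      using False snw r scalar_prod_self_pos[of ?r] by (auto simp: snw_parameters_def)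
    have \<alpha>: "\<alpha>\<^sup>2 \<le> 1" using snw by (simp add: snw_parameters_def abs_square_le_1)
    define s where "s = \<alpha> / sqrt (real M')"
    define t where "t = sqrt (1 - \<alpha>\<^sup>2) / vec_norm2 ?r"
    have "v = s \<cdot>\<^sub>v ?a + t \<cdot>\<^sub>v ?r"
      using False by (simp add: v_def steering_vector_def s_def t_def)
    then have "v \<bullet> v = s\<^sup>2 * (?a \<bullet> ?a) + t\<^sup>2 * (?r \<bullet> ?r)"
      using a r
      by (simp add: scalar_prod_add_distrib[of _ L] add_scalar_prod_distrib[of _ L] ra ar power2_eq_square)
    also have "\<dots> = \<alpha>\<^sup>2 + (1 - \<alpha>\<^sup>2)"
      using M rr \<alpha> by (simp add: aa vec_norm2_def power_divide s_def t_def)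
    finally show ?thesis by simp
  qed
qed

lemma col_key_unit: "j < M' \<Longrightarrow> col U j \<bullet> col U j = 1"
proof -
  assume j: "j < M'"
  have "(U\<^sup>T * U) $$ (j, j) = 1" using snw j by (simp add: snw_parameters_def)
  then show ?thesis using snw_carriers j by simp
qed

text \<open>Up to the sign of the bit, \<open>\<alpha> / sqrt (real M')\<close> is the cosine
  between \<open>v\<close> and each unit column of the key.\<close>

lemma col_key_steering_vector: "j < M' \<Longrightarrow> col U j \<bullet> v = \<alpha> / sqrt (real M') * c $ j"
proof -
  assume j: "j < M'"
  have "(U\<^sup>T *\<^sub>v v) $ j = \<alpha> / sqrt (real M') * c $ j"
    unfolding transpose_mult_steering_vector using snw_carriers j by simp
  then show ?thesis using snw_carriers j by simp
qed

text \<open>Equality with \<open>1\<close> is singled out because the column is then parallel to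
  \<open>v\<close> and receives no noise.\<close>

lemma amplitude_bounds:
  "0 \<le> \<alpha> / sqrt (real M')" "\<alpha> / sqrt (real M') \<le> 1"
  "\<alpha> / sqrt (real M') = 1 \<Longrightarrow> M' = 1 \<and> \<alpha> = 1"
proof -
  have M: "1 \<le> sqrt (real M')" "real M' \<ge> 1" and \<alpha>: "0 \<le> \<alpha>" "\<alpha> \<le> 1"
    using snw by (auto simp: snw_parameters_def)
  then have "\<alpha> \<le> sqrt (real M')" by linarith
  then show "0 \<le> \<alpha> / sqrt (real M')" "\<alpha> / sqrt (real M') \<le> 1"
    using M(2) \<alpha>(1) by (simp_all add: divide_le_eq_1_pos)
  assume "\<alpha> / sqrt (real M') = 1"
  then have "\<alpha> = sqrt (real M')" using M by (simp add: field_simps)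
  then have "\<alpha> = 1" "sqrt (real M') = 1" using M \<alpha> by linarith+
  then show "M' = 1 \<and> \<alpha> = 1" by simp
qed

section \<open>Probability of decoding a single bit\<close>

context
  fixes \<mu> :: "(nat \<Rightarrow> real) measure" and \<rho> :: real and j :: nat and b :: real
  assumes uniform: "uniform_on_orthogonal_sphere L v \<mu>" and \<rho>: "\<rho>\<^sup>2 < 1" and j: "j < M'"
  defines "b \<equiv> \<alpha> / sqrt (real M')"
begin

interpretation uniform_orthogonal_sphere L v \<mu>
  using steering_vector_carrier steering_vector_unit uniform by unfold_locales

lemma snw_formula_eq: "snw_formula L M' \<alpha> \<rho> = Phi (\<rho> / sqrt (1 - \<rho>\<^sup>2) * b * sqrt (real L))"
  by (simp add: snw_formula_def b_def real_sqrt_divide mult_ac)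

lemma codeword_bit: "c $ j = 1 \<or> c $ j = -1"
  using snw j by (auto simp: snw_parameters_def)

lemma transpose_mult_extracted_vector:
  "(U\<^sup>T *\<^sub>v extracted_vector \<rho> v (vec L x)) $ j =
    \<rho> * (b * c $ j) + sqrt (1 - \<rho>\<^sup>2) * (vec L x \<bullet> col U j)"
proof -
  have u: "col U j \<in> carrier_vec L" using snw_carriers j by auto
  have "(U\<^sup>T *\<^sub>v extracted_vector \<rho> v (vec L x)) $ j = col U j \<bullet> extracted_vector \<rho> v (vec L x)"
    using snw_carriers j by simp
  also have "\<dots> = \<rho> * (col U j \<bullet> v) + sqrt (1 - \<rho>\<^sup>2) * (col U j \<bullet> vec L x)"
    using u v unfolding extracted_vector_def by (simp add: scalar_prod_add_distrib[of _ L])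
  finally show ?thesis
    using u comm_scalar_prod[of "col U j" L "vec L x"] by (simp add: col_key_steering_vector[OF j] b_def)
qed

text \<open>In the degenerate case \<open>v\<close> is the column up to sign, so the noise does not touch the bit.\<close>

lemma correct_prob_degenerate:
  assumes b: "b = 1" and nz: "\<rho> \<noteq> 0"
  shows "correct_prob L \<rho> U c v \<mu> j = (if \<rho> > 0 then 1 else 0)"
proof -
  have u: "col U j \<in> carrier_vec L" using snw_carriers j by auto
  let ?w = "col U j - c $ j \<cdot>\<^sub>v v"
  have w: "?w \<in> carrier_vec L" using u v by simp
  have uv: "col U j \<bullet> v = c $ j" "v \<bullet> col U j = c $ j"
    using col_key_steering_vector[OF j] comm_scalar_prod[OF u v(1)] b unfolding b_def by (simp_all only: mult_1)
  \<comment> \<open>Equality case of Cauchy-Schwarz: two unit vectors with inner product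
    \<open>c $ j\<close>, which is \<open>1\<close> or \<open>-1\<close>, agree up to that
    sign.\<close>
  have "?w \<bullet> ?w = 0"
    using u v codeword_bit
    by (auto simp: minus_scalar_prod_distrib[of _ L] scalar_prod_minus_distrib[of _ L] uv col_key_unit[OF j])
  then have w0: "?w = 0\<^sub>v L" using scalar_prod_self_pos[of ?w] w by (auto simp del: index_minus_vec)
  have ae: "AE x in \<mu>. vec L x \<bullet> col U j = 0"
    using AE_sphere
  proof eventually_elim
    case (elim x)
    have "vec L x \<bullet> ?w = vec L x \<bullet> col U j"
      using elim u v by (simp add: scalar_prod_minus_distrib[of _ L])
    then show ?case by (simp add: w0)
  qed
  have bit: "AE x in \<mu>. decoded_bit U (extracted_vector \<rho> v (vec L x)) j = c $ j \<longleftrightarrow> \<rho> > 0"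
    using ae
  proof eventually_elim
    case (elim x)
    from codeword_bit show ?case
      unfolding decoded_bit_def transpose_mult_extracted_vector sign_def elim b
      by (rule disjE) (use nz in auto)
  qed
  have "correct_prob L \<rho> U c v \<mu> j = prob {x \<in> space \<mu>. \<rho> > 0}"
    unfolding correct_prob_def
  proof (rule measure_eq_AE)
    show "AE x in \<mu>. (x \<in> {x \<in> space \<mu>. decoded_bit U (extracted_vector \<rho> v (vec L x)) j = c $ j}) =
        (x \<in> {x \<in> space \<mu>. \<rho> > 0})"
      using bit by eventually_elim auto
  next
    have [measurable]: "(\<lambda>x. vec L x \<bullet> col U j) \<in> borel_measurable \<mu>" using u by measurable
    show "{x \<in> space \<mu>. decoded_bit U (extracted_vector \<rho> v (vec L x)) j = c $ j} \<in> sets \<mu>"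
      unfolding decoded_bit_def transpose_mult_extracted_vector sign_def by measurable
  qed auto
  then show ?thesis by (simp add: prob_space)
qed

text \<open>Removing from the column its component along \<open>v\<close> leaves a vector of length
  \<open>sqrt (1 - b\<^sup>2)\<close>, nonzero since \<open>b < 1\<close>; \<open>e\<close> is its
  direction. The bit then depends on comparing \<open>vec L x \<bullet> e\<close> with a threshold,
  and the two values of \<open>c $ j\<close> give opposite tails.\<close>

lemma correct_prob_eq_inner_cdf:
  assumes b: "b < 1"
  obtains e where "e \<in> carrier_vec L" "e \<bullet> e = 1" "e \<bullet> v = 0"
    and "correct_prob L \<rho> U c v \<mu> j =
      (if c $ j = 1 then 1 - inner_cdf e (- (\<rho> / sqrt (1 - \<rho>\<^sup>2) * b / sqrt (1 - b\<^sup>2)))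
       else inner_cdf e (\<rho> / sqrt (1 - \<rho>\<^sup>2) * b / sqrt (1 - b\<^sup>2)))"
proof -
  have u: "col U j \<in> carrier_vec L" using snw_carriers j by auto
  have b0: "0 \<le> b" using amplitude_bounds by (simp add: b_def)
  define s where "s = sqrt (1 - b\<^sup>2)"
  have "b\<^sup>2 < 1" using b b0 by (simp add: abs_square_less_1)
  then have s: "s > 0" "s * s = 1 - b * b" by (simp_all add: s_def power2_eq_square)
  define k where "k = sqrt (1 - \<rho>\<^sup>2)"
  have k: "k > 0" using \<rho> by (simp add: k_def)
  let ?w = "col U j - (b * c $ j) \<cdot>\<^sub>v v"
  have w: "?w \<in> carrier_vec L" using u v by simp
  have uv: "col U j \<bullet> v = b * c $ j" "v \<bullet> col U j = b * c $ j"
    using col_key_steering_vector[OF j] comm_scalar_prod[OF u v(1)] by (simp_all add: b_def)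
  have ww: "?w \<bullet> ?w = s\<^sup>2"
    using u v codeword_bit
    by (auto simp: minus_scalar_prod_distrib[of _ L] scalar_prod_minus_distrib[of _ L] uv col_key_unit[OF j] s(2) power2_eq_square)
  have wv: "?w \<bullet> v = 0"
    using u v by (simp add: minus_scalar_prod_distrib[of _ L] uv)
  define e where "e = (1 / s) \<cdot>\<^sub>v ?w"
  have e: "e \<in> carrier_vec L" "e \<bullet> e = 1" "e \<bullet> v = 0"
    using w ww wv v s(1) by (simp_all add: e_def power2_eq_square del: index_minus_vec)
  have ae: "AE x in \<mu>. vec L x \<bullet> col U j = s * (vec L x \<bullet> e)"
    using AE_sphere
  proof eventually_elim
    case (elim x)
    have "vec L x \<bullet> ?w = vec L x \<bullet> col U j"
      using elim u v by (simp add: scalar_prod_minus_distrib[of _ L])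
    moreover have "vec L x \<bullet> e = (vec L x \<bullet> ?w) / s"
      using w by (simp add: e_def)
    ultimately show ?case using s(1) by simp
  qed
  have [measurable]: "(\<lambda>x. vec L x \<bullet> col U j) \<in> borel_measurable \<mu>" "(\<lambda>x. vec L x \<bullet> e) \<in> borel_measurable \<mu>"
    using u e by measurable
  let ?y = "\<rho> / k * b / s"
  \<comment> \<open>Since \<open>sign 0 = -1\<close>, a bit \<open>1\<close> requires a strict
    inequality while a bit \<open>-1\<close> allows equality. Hence one event is the complement of a
    closed lower tail and the other is a closed lower tail.\<close>
  let ?E = "{x \<in> space \<mu>. if c $ j = 1 then \<not> vec L x \<bullet> e \<le> - ?y else vec L x \<bullet> e \<le> ?y}"
  have "correct_prob L \<rho> U c v \<mu> j = prob ?E"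
    unfolding correct_prob_def
  proof (rule measure_eq_AE)
    show "AE x in \<mu>. (x \<in> {x \<in> space \<mu>. decoded_bit U (extracted_vector \<rho> v (vec L x)) j = c $ j}) = (x \<in> ?E)"
      using ae
    proof eventually_elim
      case (elim x)
      let ?z = "vec L x \<bullet> e"
      have ks: "k * s > 0" using k s(1) by simp
      have up: "\<rho> * b + k * (s * ?z) > 0 \<longleftrightarrow> - ?y < ?z"
      proof -
        have "- ?y < ?z \<longleftrightarrow> - (\<rho> * b) < ?z * (k * s)"
          using pos_divide_less_eq[OF ks, of "- (\<rho> * b)" ?z] by (simp add: mult_ac)
        then show ?thesis by (auto simp: mult_ac)
      qed
      have down: "- (\<rho> * b) + k * (s * ?z) > 0 \<longleftrightarrow> ?y < ?z"
      proof -
        have "?y < ?z \<longleftrightarrow> \<rho> * b < ?z * (k * s)"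
          using pos_divide_less_eq[OF ks, of "\<rho> * b" ?z] by (simp add: mult_ac)
        then show ?thesis by (auto simp: mult_ac)
      qed
      have bit: "(U\<^sup>T *\<^sub>v extracted_vector \<rho> v (vec L x)) $ j = \<rho> * (b * c $ j) + k * (s * ?z)"
        using elim transpose_mult_extracted_vector by (simp only: k_def)
      from codeword_bit show ?case
      proof
        assume c1: "c $ j = 1"
        have "0 < (U\<^sup>T *\<^sub>v extracted_vector \<rho> v (vec L x)) $ j \<longleftrightarrow> - ?y < ?z"
          unfolding bit c1 using up by (simp only: mult_1_right)
        then show ?thesis using c1 by (simp add: decoded_bit_def sign_def not_le)
      next
        assume c1: "c $ j = -1"
        have "0 < (U\<^sup>T *\<^sub>v extracted_vector \<rho> v (vec L x)) $ j \<longleftrightarrow> ?y < ?z"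
          unfolding bit c1 using down by (simp only: mult_minus_right mult_1_right)
        then show ?thesis using c1 by (simp add: decoded_bit_def sign_def not_le[symmetric])
      qed
    qed
  next
    show "{x \<in> space \<mu>. decoded_bit U (extracted_vector \<rho> v (vec L x)) j = c $ j} \<in> sets \<mu>"
      unfolding decoded_bit_def transpose_mult_extracted_vector sign_def by measurable
    show "?E \<in> sets \<mu>" by measurable
  qed
  also have "\<dots> = (if c $ j = 1 then 1 - inner_cdf e (- ?y) else inner_cdf e ?y)"
    using e(1) by (simp add: inner_cdf_def prob_neg)
  finally show ?thesis using that[OF e] by (simp add: k_def s_def)
qed

text \<open>The symmetry of \<open>Phi\<close> gives both bit values the same Gaussian
  approximation.\<close>

lemma correct_prob_approx:
  assumes "b < 1" and \<eta>: "0 < \<eta>" "\<eta> < 1"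
  shows "\<bar>correct_prob L \<rho> U c v \<mu> j - Phi (\<rho> / sqrt (1 - \<rho>\<^sup>2) * b / sqrt (1 - b\<^sup>2) * sqrt (real L))\<bar> \<le>
    8 / (\<eta>\<^sup>2 * real L) + 2 / (\<eta> * real L) + (1 / sqrt (1 - \<eta>) - 1)"
proof -
  let ?y = "\<rho> / sqrt (1 - \<rho>\<^sup>2) * b / sqrt (1 - b\<^sup>2)"
  obtain e where e: "e \<in> carrier_vec L" "e \<bullet> e = 1" "e \<bullet> v = 0"
    and p: "correct_prob L \<rho> U c v \<mu> j = (if c $ j = 1 then 1 - inner_cdf e (- ?y) else inner_cdf e ?y)"
    using correct_prob_eq_inner_cdf[OF assms(1)] by metis
  have L: "L > 0" using snw by (simp add: snw_parameters_def)
  have "Phi (?y * sqrt (real L)) = 1 - Phi (- ?y * sqrt (real L))"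
    using Phi_minus[of "?y * sqrt (real L)"] by simp
  show ?thesis
  proof (cases "c $ j = 1")
    case True
    have "\<bar>(1 - inner_cdf e (- ?y)) - Phi (?y * sqrt (real L))\<bar> =
        \<bar>inner_cdf e (- ?y) - Phi (- ?y * sqrt (real L))\<bar>"
      unfolding \<open>Phi (?y * sqrt (real L)) = _\<close> by (simp add: abs_minus_commute)
    then show ?thesis
      unfolding p if_P[OF True] using inner_cdf_approx_Phi[OF e \<eta> L, of "- ?y"] by (simp only:)
  next
    case False
    then show ?thesis
      unfolding p if_not_P[OF False] by (intro inner_cdf_approx_Phi[OF e \<eta> L])
  qed
qed

end

end

section \<open>Limits for large \<open>L\<close>, uniform in the remaining parameters\<close>

lemma Phi_amplitude_uniform:
  assumes \<epsilon>: "\<epsilon> > 0"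
  shows "\<forall>\<^sub>F L in sequentially. \<forall>b. 0 \<le> b \<and> b < 1 \<longrightarrow>
    \<bar>Phi (r * b / sqrt (1 - b\<^sup>2) * sqrt (real L)) - Phi (r * b * sqrt (real L))\<bar> < \<epsilon>"
proof -
  \<comment> \<open>\<open>\<beta>\<close> separates small amplitudes, where the factor
    \<open>1 / sqrt (1 - b\<^sup>2)\<close> costs less than \<open>\<epsilon>\<close>, from larger
    ones, where nonzero \<open>r\<close> makes the arguments grow with \<open>L\<close>.\<close>
  have "((\<lambda>\<beta>. 1 / sqrt (1 - \<beta>\<^sup>2) - 1) \<longlongrightarrow> 0) (at_right (0::real))" by real_asymp
  then have "\<forall>\<^sub>F \<beta> in at_right (0::real). 1 / sqrt (1 - \<beta>\<^sup>2) - 1 < \<epsilon>"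
    using \<epsilon> by (rule order_tendstoD)
  moreover have "\<forall>\<^sub>F \<beta> in at_right (0::real). 0 < \<beta> \<and> \<beta> < 1"
    by (simp add: eventually_at_right_field) (auto intro!: exI[of _ 1])
  ultimately have "\<forall>\<^sub>F \<beta> in at_right (0::real). 1 / sqrt (1 - \<beta>\<^sup>2) - 1 < \<epsilon> \<and> 0 < \<beta> \<and> \<beta> < 1"
    by eventually_elim auto
  then obtain \<beta> :: real where \<beta>: "1 / sqrt (1 - \<beta>\<^sup>2) - 1 < \<epsilon>" "0 < \<beta>" "\<beta> < 1"
    using eventually_happens'[OF trivial_limit_at_right_real] by blast
  have large: "\<forall>\<^sub>F L in sequentially. r = 0 \<or> Phi (\<bar>r\<bar> * \<beta> * sqrt (real L)) > 1 - \<epsilon>"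
  proof (cases "r = 0")
    case False
    then have "filterlim (\<lambda>L::nat. \<bar>r\<bar> * \<beta> * sqrt (real L)) at_top sequentially"
      using \<beta>(2) by (intro filterlim_tendsto_pos_mult_at_top[OF tendsto_const] filterlim_compose[OF sqrt_at_top] filterlim_real_sequentially) auto
    then have "((\<lambda>L. Phi (\<bar>r\<bar> * \<beta> * sqrt (real L))) \<longlongrightarrow> 1) sequentially"
      by (rule filterlim_compose[OF Phi_tendsto_1])
    then have "\<forall>\<^sub>F L in sequentially. Phi (\<bar>r\<bar> * \<beta> * sqrt (real L)) > 1 - \<epsilon>"
      using \<epsilon> by (intro order_tendstoD(1)) auto
    then show ?thesis by (rule eventually_mono) simp
  qed simp
  then show ?thesis
  proof (rule eventually_mono, intro allI impI)
    fix L b assume L: "r = 0 \<or> Phi (\<bar>r\<bar> * \<beta> * sqrt (real L)) > 1 - \<epsilon>" and b: "0 \<le> b \<and> b < (1::real)"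
    let ?s = "sqrt (1 - b\<^sup>2)" and ?x = "r * b * sqrt (real L)"
    have "b\<^sup>2 < 1" using b by (simp add: abs_square_less_1)
    then have s: "0 < ?s" "?s \<le> 1" by simp_all
    then have s1: "1 \<le> 1 / ?s" by simp
    have eq: "r * b / ?s * sqrt (real L) = 1 / ?s * ?x" by simp
    show "\<bar>Phi (r * b / ?s * sqrt (real L)) - Phi ?x\<bar> < \<epsilon>"
    proof (cases "b \<le> \<beta>")
      case True
      have "\<beta>\<^sup>2 < 1" using \<beta> by (simp add: abs_square_less_1)
      moreover have "b\<^sup>2 \<le> \<beta>\<^sup>2" using True b by (intro power_mono) auto
      ultimately have "1 / ?s \<le> 1 / sqrt (1 - \<beta>\<^sup>2)"
        using s by (intro divide_left_mono) auto
      then show ?thesis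
        unfolding eq using Phi_scale_diff_le[OF s1, of ?x] \<beta>(1) by linarith
    next
      case False
      show ?thesis
      proof (cases "r = 0")
        \<comment> \<open>Both arguments have the same sign and absolute value at least
          \<open>\<bar>r\<bar> * \<beta> * sqrt (real L)\<close>. So both values of
          \<open>Phi\<close> are within \<open>\<epsilon>\<close> of \<open>1\<close>, or of
          \<open>0\<close> after reflection.\<close>
        case nz: False
        let ?z = "\<bar>r\<bar> * b * sqrt (real L)"
        have "\<bar>r\<bar> * \<beta> * sqrt (real L) \<le> ?z"
          using False by (intro mult_right_mono mult_left_mono) auto
        then have z: "Phi ?z > 1 - \<epsilon>" using L nz Phi_mono[of "\<bar>r\<bar> * \<beta> * sqrt (real L)" ?z] by linarith
        have "?z \<le> 1 / ?s * ?z"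
          using s1 b mult_right_mono[OF s1, of ?z] by simp
        then have close: "\<bar>Phi (1 / ?s * ?z) - Phi ?z\<bar> < \<epsilon>"
          using z Phi_mono[of ?z "1 / ?s * ?z"] Phi_bounds(2)[of "1 / ?s * ?z"] by linarith
        have "?z = ?x \<or> ?z = - ?x" by (simp add: abs_if)
        then show ?thesis
        proof
          assume z: "?z = ?x"
          show ?thesis using close unfolding eq z .
        next
          assume z: "?z = - ?x"
          have "Phi (1 / ?s * ?z) = 1 - Phi (1 / ?s * ?x)" "Phi ?z = 1 - Phi ?x"
            unfolding z mult_minus_right by (rule Phi_minus)+
          then show ?thesis using close unfolding eq by linarith
        qed
      qed (use \<epsilon> in simp)
    qed
  qed
qed

text \<open>The threshold for \<open>L\<close> depends on \<open>\<rho>\<close> and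
  \<open>\<epsilon>\<close> alone. In the excluded case the decoded coordinate is almost surely
  \<open>0\<close> and the bit is read as \<open>-1\<close>, so the probability is \<open>0\<close>
  or \<open>1\<close> while the formula gives \<open>Phi 0 = 1 / 2\<close>.\<close>

theorem correct_prob_asymptotic:
  assumes \<rho>: "\<rho>\<^sup>2 < 1" and \<epsilon>: "\<epsilon> > 0"
  shows "\<forall>\<^sub>F L in sequentially. \<forall>M' \<alpha> U c q \<mu> j.
    snw_parameters L M' \<alpha> U c q \<and>
    uniform_on_orthogonal_sphere L (steering_vector L M' \<alpha> U c q) \<mu> \<and>
    j < M' \<and> \<not> (M' = 1 \<and> \<alpha> = 1 \<and> \<rho> = 0) \<longrightarrow>
      \<bar>correct_prob L \<rho> U c (steering_vector L M' \<alpha> U c q) \<mu> j - snw_formula L M' \<alpha> \<rho>\<bar> < \<epsilon>"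
proof -
  define r where "r = \<rho> / sqrt (1 - \<rho>\<^sup>2)"
  \<comment> \<open>Error budget for \<open>b < 1\<close>: \<open>\<epsilon> / 4\<close> for the
    radius window, \<open>\<epsilon> / 4\<close> for concentration (\<open>E1\<close>), and
    \<open>\<epsilon> / 2\<close> for removing \<open>sqrt (1 - b\<^sup>2)\<close>
    (\<open>E2\<close>).\<close>
  have "((\<lambda>\<eta>. 1 / sqrt (1 - \<eta>) - 1) \<longlongrightarrow> 0) (at_right (0::real))" by real_asymp
  then have "\<forall>\<^sub>F \<eta> in at_right (0::real). 1 / sqrt (1 - \<eta>) - 1 < \<epsilon> / 4"
    using \<epsilon> by (intro order_tendstoD(2)) auto
  moreover have "\<forall>\<^sub>F \<eta> in at_right (0::real). 0 < \<eta> \<and> \<eta> < 1"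
    by (simp add: eventually_at_right_field) (auto intro!: exI[of _ 1])
  ultimately have "\<forall>\<^sub>F \<eta> in at_right (0::real). 1 / sqrt (1 - \<eta>) - 1 < \<epsilon> / 4 \<and> 0 < \<eta> \<and> \<eta> < 1"
    by eventually_elim auto
  then obtain \<eta> :: real where \<eta>: "1 / sqrt (1 - \<eta>) - 1 < \<epsilon> / 4" "0 < \<eta>" "\<eta> < 1"
    using eventually_happens'[OF trivial_limit_at_right_real] by blast
  have "((\<lambda>L::nat. 8 / (\<eta>\<^sup>2 * real L) + 2 / (\<eta> * real L)) \<longlongrightarrow> 0) sequentially"
    using \<eta>(2) by real_asymp
  then have E1: "\<forall>\<^sub>F L in sequentially. 8 / (\<eta>\<^sup>2 * real L) + 2 / (\<eta> * real L) < \<epsilon> / 4"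
    using \<epsilon> by (intro order_tendstoD(2)) auto
  have E2: "\<forall>\<^sub>F L in sequentially. \<forall>b. 0 \<le> b \<and> b < 1 \<longrightarrow>
      \<bar>Phi (r * b / sqrt (1 - b\<^sup>2) * sqrt (real L)) - Phi (r * b * sqrt (real L))\<bar> < \<epsilon> / 2"
    using \<epsilon> by (intro Phi_amplitude_uniform) auto
  \<comment> \<open>Serves the case \<open>b = 1\<close>: the bit is then deterministic for nonzero
    \<open>\<rho>\<close>, and the formula must itself be close to \<open>1\<close> or
    \<open>0\<close>.\<close>
  have E3: "\<forall>\<^sub>F L in sequentially. \<rho> = 0 \<or> 1 - \<epsilon> < Phi (\<bar>r\<bar> * sqrt (real L))"
  proof (cases "\<rho> = 0")
    case False
    then have "0 < \<bar>r\<bar>" using \<rho> by (simp add: r_def)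
    then have "filterlim (\<lambda>L::nat. \<bar>r\<bar> * sqrt (real L)) at_top sequentially"
      by (intro filterlim_tendsto_pos_mult_at_top[OF tendsto_const] filterlim_compose[OF sqrt_at_top] filterlim_real_sequentially) auto
    then have "((\<lambda>L. Phi (\<bar>r\<bar> * sqrt (real L))) \<longlongrightarrow> 1) sequentially"
      by (rule filterlim_compose[OF Phi_tendsto_1])
    then have "\<forall>\<^sub>F L in sequentially. 1 - \<epsilon> < Phi (\<bar>r\<bar> * sqrt (real L))"
      using \<epsilon> by (intro order_tendstoD(1)) auto
    then show ?thesis by (rule eventually_mono) simp
  qed simp
  from E1 E2 E3 show ?thesis
  proof eventually_elim
    case (elim L)
    show ?case
    proof (intro allI impI, elim conjE)
      fix M' \<alpha> U c q \<mu> j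
      let ?v = "steering_vector L M' \<alpha> U c q" and ?b = "\<alpha> / sqrt (real M')"
      assume snw: "snw_parameters L M' \<alpha> U c q" and uniform: "uniform_on_orthogonal_sphere L ?v \<mu>"
        and j: "j < M'" and nondeg: "\<not> (M' = 1 \<and> \<alpha> = 1 \<and> \<rho> = 0)"
      note params = snw uniform \<rho> j
      have formula: "snw_formula L M' \<alpha> \<rho> = Phi (r * ?b * sqrt (real L))"
        unfolding r_def by (rule snw_formula_eq[OF params])
      show "\<bar>correct_prob L \<rho> U c ?v \<mu> j - snw_formula L M' \<alpha> \<rho>\<bar> < \<epsilon>"
      proof (cases "?b < 1")
        case True
        have "\<bar>correct_prob L \<rho> U c ?v \<mu> j - Phi (r * ?b / sqrt (1 - ?b\<^sup>2) * sqrt (real L))\<bar> < \<epsilon> / 2"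
          using correct_prob_approx[OF params True \<eta>(2,3)] \<eta>(1) elim(1) unfolding r_def by linarith
        moreover have "\<bar>Phi (r * ?b / sqrt (1 - ?b\<^sup>2) * sqrt (real L)) - Phi (r * ?b * sqrt (real L))\<bar> < \<epsilon> / 2"
          using elim(2) True amplitude_bounds(1)[OF snw] by blast
        ultimately show ?thesis unfolding formula by linarith
      next
        case False
        then have b: "?b = 1" using amplitude_bounds(2)[OF snw] by linarith
        then have nz: "\<rho> \<noteq> 0" using amplitude_bounds(3)[OF snw] nondeg by blast
        have p: "correct_prob L \<rho> U c ?v \<mu> j = (if \<rho> > 0 then 1 else 0)"
          by (rule correct_prob_degenerate[OF params b nz])
        have big: "1 - \<epsilon> < Phi (\<bar>r\<bar> * sqrt (real L))" using elim(3) nz by blast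
        have k: "sqrt (1 - \<rho>\<^sup>2) > 0" using \<rho> by simp
        show ?thesis
        proof (cases "\<rho> > 0")
          case True
          then have "\<bar>r\<bar> = r" using k by (simp add: r_def)
          then show ?thesis
            using big Phi_bounds(2)[of "r * sqrt (real L)"] True unfolding formula p b by simp
        next
          case False
          then have r: "\<bar>r\<bar> = - r" using k by (simp add: r_def divide_nonpos_pos)
          show ?thesis
            using big Phi_minus[of "r * sqrt (real L)"] Phi_bounds(1)[of "r * sqrt (real L)"] False
            unfolding formula p b r by simp
        qed
      qed
    qed
  qed
qed

text \<open>The Gaussian value is a large-dimension approximation, so its equality with the bit
  probability is stated as uniform convergence. The capacities are compared per bit, because the
  entropy error is multiplied by \<open>M'\<close>, which may grow with \<open>L\<close>. The
  capacity formula itself holds exactly, both at the true probability and at the Gaussian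
  value.\<close>

theorem proposition2:
  fixes \<rho> :: real
  assumes "\<rho>\<^sup>2 < 1"
  shows "(\<forall>\<epsilon>>0. \<forall>\<^sub>F L in sequentially. \<forall>M' \<alpha> U c q \<mu> j.
            snw_parameters L M' \<alpha> U c q \<and>
            uniform_on_orthogonal_sphere L (steering_vector L M' \<alpha> U c q) \<mu> \<and>
            j < M' \<and> \<not> (M' = 1 \<and> \<alpha> = 1 \<and> \<rho> = 0) \<longrightarrow>
              (let p = correct_prob L \<rho> U c (steering_vector L M' \<alpha> U c q) \<mu> j
               in \<bar>p - snw_formula L M' \<alpha> \<rho>\<bar> < \<epsilon> \<and>
                  \<bar>snw_capacity M' p / real M' - (1 - binary_entropy (snw_formula L M' \<alpha> \<rho>))\<bar> < \<epsilon>)) \<and>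
         (\<forall>L M' \<alpha> U c q \<mu> j.
            snw_parameters L M' \<alpha> U c q \<and>
            uniform_on_orthogonal_sphere L (steering_vector L M' \<alpha> U c q) \<mu> \<and>
            j < M' \<longrightarrow>
              (let p = correct_prob L \<rho> U c (steering_vector L M' \<alpha> U c q) \<mu> j
               in snw_capacity M' p = real M' * (1 - binary_entropy p)) \<and>
              snw_capacity M' (snw_formula L M' \<alpha> \<rho>) =
                real M' * (1 - binary_entropy (snw_formula L M' \<alpha> \<rho>)))"
proof (intro conjI allI impI)
  have prob: "correct_prob L \<rho> U c v \<mu> j \<in> {0..1}" if "uniform_on_orthogonal_sphere L v \<mu>" for L U c v \<mu> j
  proof -
    interpret prob_space \<mu> using that by (simp add: uniform_on_orthogonal_sphere_def)
    show ?thesis by (simp add: correct_prob_def)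
  qed
  have formula: "snw_formula L M' \<alpha> \<rho> \<in> {0..1}" for L M' \<alpha>
    by (simp add: snw_formula_def Phi_bounds)
  {
    fix \<epsilon> :: real assume \<epsilon>: "\<epsilon> > 0"
    \<comment> \<open>Uniform continuity gives one \<open>d\<close> for all parameters, although the
      Gaussian value varies with \<open>L\<close>, \<open>M'\<close> and
      \<open>\<alpha>\<close>.\<close>
    have "uniformly_continuous_on {0..1} binary_entropy"
      by (intro compact_uniformly_continuous continuous_on_binary_entropy) simp
    then obtain d where d: "d > 0"
      "\<And>x y. x \<in> {0..1} \<Longrightarrow> y \<in> {0..1} \<Longrightarrow> \<bar>x - y\<bar> < d \<Longrightarrow> \<bar>binary_entropy x - binary_entropy y\<bar> < \<epsilon>"
      using \<epsilon> unfolding uniformly_continuous_on_def dist_real_def by metis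
    have "min d \<epsilon> > 0" using d \<epsilon> by simp
    from correct_prob_asymptotic[OF assms this]
    show "\<forall>\<^sub>F L in sequentially. \<forall>M' \<alpha> U c q \<mu> j.
            snw_parameters L M' \<alpha> U c q \<and>
            uniform_on_orthogonal_sphere L (steering_vector L M' \<alpha> U c q) \<mu> \<and>
            j < M' \<and> \<not> (M' = 1 \<and> \<alpha> = 1 \<and> \<rho> = 0) \<longrightarrow>
              (let p = correct_prob L \<rho> U c (steering_vector L M' \<alpha> U c q) \<mu> j
               in \<bar>p - snw_formula L M' \<alpha> \<rho>\<bar> < \<epsilon> \<and>
                  \<bar>snw_capacity M' p / real M' - (1 - binary_entropy (snw_formula L M' \<alpha> \<rho>))\<bar> < \<epsilon>)"
    proof (rule eventually_mono, intro allI impI)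
      fix L M' \<alpha> U c q \<mu> j
      let ?p = "correct_prob L \<rho> U c (steering_vector L M' \<alpha> U c q) \<mu> j"
      let ?f = "snw_formula L M' \<alpha> \<rho>"
      assume close: "\<forall>M' \<alpha> U c q \<mu> j.
          snw_parameters L M' \<alpha> U c q \<and>
          uniform_on_orthogonal_sphere L (steering_vector L M' \<alpha> U c q) \<mu> \<and>
          j < M' \<and> \<not> (M' = 1 \<and> \<alpha> = 1 \<and> \<rho> = 0) \<longrightarrow>
            \<bar>correct_prob L \<rho> U c (steering_vector L M' \<alpha> U c q) \<mu> j - snw_formula L M' \<alpha> \<rho>\<bar> < min d \<epsilon>"
        and params: "snw_parameters L M' \<alpha> U c q \<and>
          uniform_on_orthogonal_sphere L (steering_vector L M' \<alpha> U c q) \<mu> \<and>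
          j < M' \<and> \<not> (M' = 1 \<and> \<alpha> = 1 \<and> \<rho> = 0)"
      have pf: "\<bar>?p - ?f\<bar> < min d \<epsilon>" using close params by blast
      have p: "?p \<in> {0..1}" using params prob by blast
      have "\<bar>binary_entropy ?p - binary_entropy ?f\<bar> < \<epsilon>"
        using pf by (intro d(2) p formula) simp
      moreover have "snw_capacity M' ?p / real M' = 1 - binary_entropy ?p"
        using params by (simp add: snw_capacity_eq[OF p])
      ultimately show "let p = ?p in \<bar>p - ?f\<bar> < \<epsilon> \<and>
          \<bar>snw_capacity M' p / real M' - (1 - binary_entropy ?f)\<bar> < \<epsilon>"
        using pf by (simp add: abs_minus_commute)
    qed
  }
  fix L M' \<alpha> U c q \<mu> j
  assume params: "snw_parameters L M' \<alpha> U c q \<and>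
    uniform_on_orthogonal_sphere L (steering_vector L M' \<alpha> U c q) \<mu> \<and> j < M'"
  show "let p = correct_prob L \<rho> U c (steering_vector L M' \<alpha> U c q) \<mu> j
    in snw_capacity M' p = real M' * (1 - binary_entropy p)"
    unfolding Let_def using params prob snw_capacity_eq by blast
  show "snw_capacity M' (snw_formula L M' \<alpha> \<rho>) = real M' * (1 - binary_entropy (snw_formula L M' \<alpha> \<rho>))"
    by (rule snw_capacity_eq[OF formula])
qed

end
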